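(* Let $p$ be an odd prime, let $k>1$ be an odd integer, let $m$ be the multiplicative order of $p$ modulo $k$, and let $q=p^f=p^{sm}$ with $s$ a positive integer. Assume that $k$ divides $\frac{q-1}{p-1}$ and that the Cayley graph $\mathrm{Cay}(\mathbb{F}_q,C_0^{(k,q)})$ is strongly regular. Let $\gamma$ be a primitive root of $\mathbb{F}_q$, let $\chi_k$ be a multiplicative character of order $k$ of $\mathbb{F}_q$, and let $\theta$ be the integer such that $p^\theta$ exactly divides the Gauss sum $G_m(\chi_k')$, where $\chi_k'$ is a multiplicative character of order $k$ of $\mathbb{F}_{p^m}$. Let $L$ be a system of coset representatives of $\mathbb{F}_q^\ast/C_0^{(k,q)}$ and let $L=L_1\cup L_2$ be a partition (disjoint union) such that \[ G_f(\chi_k)=\epsilon p^{s\theta}\sum_{x\in L_1}\chi_k(x)=-\epsilon p^{s\theta}\sum_{x\in L_2}\chi_k(x) \] for some $\epsilon\in\{1,-1\}$. Fix $i\in\{1,2\}$ and assume that $L_i\cap C_0^{(k,q)}=\emptyset$. Let \[ L'=\{y \bmod k \,:\, \gamma^{-y}\in L_i,\ 0\le y\le q-2\}\subseteq \mathbb{Z}/k\mathbb{Z}, \] and let $I\subseteq\mathbb{Z}/2k\mathbb{Z}$ be the $|L_i|$-element set of odd residues modulo $2k$ whose reduction modulo $k$ equals $L'$. Set \[ J=\{0\}\cup I\cup 2\Big((\mathbb{Z}/k\mathbb{Z})\setminus 2^{-1}\cdot(L'\cup\{0\})\Big)\pmod{2k}, \] where $2^{-1}$ denotes the inverse of $2$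 modulo $k$ and, for a subset $Y\subseteq\mathbb{Z}/k\mathbb{Z}$, $2Y$ denotes $\{2y \bmod 2k: y\in Y\}$. Let $D=\bigcup_{j\in J}C_j^{(2k,q)}\subseteq\mathbb{F}_q$. Then for every $a\in\mathbb{F}_q^\ast$, \[ \psi(aD)=\frac{-1\pm\sqrt{\delta q}}{2}, \] where $\delta=-1$ if $q\equiv 3\pmod 4$ and $\delta=1$ if $q\equiv 1\pmod 4$. Consequently $D$ is a skew Hadamard difference set in $(\mathbb{F}_q,+)$ if $q\equiv 3\pmod 4$, and a Paley type partial difference set in $(\mathbb{F}_q,+)$ if $q\equiv 1\pmod 4$.
   Context: For a prime power $q$, a primitive root $\gamma$ of $\mathbb{F}_q$, and $N\mid q-1$, the cyclotomic classes of order $N$ are $C_j^{(N,q)}=\gamma^j\langle\gamma^N\rangle$, $0\le j\le N-1$ (indices read modulo $N$). $\psi$ denotes the canonical additive character of $\mathbb{F}_q$, $\psi(x)=\zeta_p^{\mathrm{Tr}_{q/p}(x)}$ with $\zeta_p=e^{2\pi i/p}$, and for a set $S$, $\psi(S)=\sum_{x\in S}\psi(x)$. For a multiplicative character $\chi$ of $\mathbb{F}_{p^f}$, the Gauss sum is $G_f(\chi)=\sum_{x\in\mathbb{F}_{p^f}^\ast}\chi(x)\psi(x)$; $p^\theta$ "exactly divides" means $p^\theta$ divides it and $p^{\theta+1}$ does not, in the ring of algebraic integers. $\mathrm{Cay}(G,S)$ is the Cayley graph on $G$ with connection set $S$. A subset $D$ of an abelian group $G$ of odd order $v$ is a skew Hadamard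 difference set if it is a difference set and $G$ is the disjoint union of $D$, $-D$, $\{0\}$; it is a Paley type partial difference set if $\mathrm{Cay}(G,D)$ is strongly regular with parameters $(v,(v-1)/2,(v-5)/4,(v-1)/4)$.
   Formalization: For composite k the display for G_f(χ_k) with L_1, ε, θ is also assumed for the nontrivial powers of χ_k of order less than k; without this the claim fails (e.g. p=7, k=57, q=343). For prime k nothing is added. *)

theory Defs
  imports
    Complex_Main
    "HOL-Library.Cardinality"
    "HOL-Computational_Algebra.Computational_Algebra"
    "HOL-Number_Theory.Number_Theory"
begin

section \<open>Characters and Gauss sums of finite fields\<close>

definition ff_degree :: "'a::finite_field itself \<Rightarrow> nat" where
  "ff_degree _ = (THE n. CARD('a) = CHAR('a) ^ n)"

definition abs_trace :: "'a::finite_field \<Rightarrow> 'a" where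
  "abs_trace x = (\<Sum>i<ff_degree TYPE('a). x ^ (CHAR('a) ^ i))"

text \<open>The trace lies in the prime field, i.e. it is \<^term>\<open>of_nat t\<close> for a unique
  \<open>t\<close> below the characteristic; this \<open>t\<close> is the exponent of \<open>exp(2\<pi>i/p)\<close>.\<close>

definition canonical_char :: "'a::finite_field \<Rightarrow> complex" where
  "canonical_char x =
     cis (2 * pi * real (LEAST t. of_nat t = abs_trace x) / real CHAR('a))"

definition char_sum :: "'a::finite_field set \<Rightarrow> complex" where
  "char_sum S = (\<Sum>x\<in>S. canonical_char x)"

text \<open>A multiplicative character is a homomorphism on the nonzero elements. Its value at \<open>0\<close>
  is left unconstrained, and nothing below evaluates it there.\<close>

definition mult_char :: "('a::finite_field \<Rightarrow> complex) \<Rightarrow> bool" where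
  "mult_char c \<longleftrightarrow>
     (\<forall>x. x \<noteq> 0 \<longrightarrow> c x \<noteq> 0) \<and>
     (\<forall>x y. x \<noteq> 0 \<longrightarrow> y \<noteq> 0 \<longrightarrow> c (x * y) = c x * c y)"

definition mult_char_order :: "('a::finite_field \<Rightarrow> complex) \<Rightarrow> nat" where
  "mult_char_order c = (LEAST n. n > 0 \<and> (\<forall>x. x \<noteq> 0 \<longrightarrow> c x ^ n = 1))"

definition gauss_sum :: "('a::finite_field \<Rightarrow> complex) \<Rightarrow> complex" where
  "gauss_sum c = (\<Sum>x\<in>UNIV - {0}. c x * canonical_char x)"

definition algebraic_int_dvd :: "complex \<Rightarrow> complex \<Rightarrow> bool" where
  "algebraic_int_dvd a b \<longleftrightarrow> (\<exists>z. algebraic_int z \<and> b = a * z)"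

definition exactly_divides :: "nat \<Rightarrow> nat \<Rightarrow> complex \<Rightarrow> bool" where
  "exactly_divides p t z \<longleftrightarrow>
     algebraic_int_dvd (of_nat p ^ t) z \<and> \<not> algebraic_int_dvd (of_nat p ^ (t + 1)) z"


section \<open>Cyclotomic classes\<close>

definition primitive_element :: "'a::finite_field \<Rightarrow> bool" where
  "primitive_element \<gamma> \<longleftrightarrow> \<gamma> \<noteq> 0 \<and> (\<forall>x. x \<noteq> 0 \<longrightarrow> (\<exists>n::nat. x = \<gamma> ^ n))"

definition cyclotomic_class :: "'a::finite_field \<Rightarrow> nat \<Rightarrow> nat \<Rightarrow> 'a set" where
  "cyclotomic_class \<gamma> N j = {\<gamma> ^ j * (\<gamma> ^ N) ^ i | i::nat. True}"

definition coset_representatives :: "'a::finite_field set \<Rightarrow> 'a set \<Rightarrow> bool" where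
  "coset_representatives C L \<longleftrightarrow>
     L \<subseteq> UNIV - {0} \<and> (\<forall>x. x \<noteq> 0 \<longrightarrow> (\<exists>!y. y \<in> L \<and> y \<in> (\<lambda>c. x * c) ` C))"


section \<open>Strongly regular graphs and difference sets\<close>

text \<open>Graphs are given by their adjacency relation, with all elements of the type as vertices.\<close>

definition cayley_graph :: "'g::ab_group_add set \<Rightarrow> 'g \<Rightarrow> 'g \<Rightarrow> bool" where
  "cayley_graph S x y \<longleftrightarrow> y - x \<in> S"

text \<open>Complete and edgeless graphs are excluded; disconnected graphs are not.\<close>

definition srg :: "('v::finite \<Rightarrow> 'v \<Rightarrow> bool) \<Rightarrow> nat \<Rightarrow> nat \<Rightarrow> nat \<Rightarrow> nat \<Rightarrow> bool" where
  "srg E v \<kappa> l \<mu> \<longleftrightarrow>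
     CARD('v) = v \<and>
     (\<forall>x y. E x y \<longrightarrow> E y x) \<and> (\<forall>x. \<not> E x x) \<and>
     (\<exists>x y. E x y) \<and> (\<exists>x y. x \<noteq> y \<and> \<not> E x y) \<and>
     (\<forall>x. card {y. E x y} = \<kappa>) \<and>
     (\<forall>x y. E x y \<longrightarrow> card {z. E x z \<and> E y z} = l) \<and>
     (\<forall>x y. x \<noteq> y \<longrightarrow> \<not> E x y \<longrightarrow> card {z. E x z \<and> E y z} = \<mu>)"

definition strongly_regular :: "('v::finite \<Rightarrow> 'v \<Rightarrow> bool) \<Rightarrow> bool" where
  "strongly_regular E \<longleftrightarrow> (\<exists>v \<kappa> l \<mu>. srg E v \<kappa> l \<mu>)"

definition difference_set :: "'g::{ab_group_add,finite} set \<Rightarrow> bool" where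
  "difference_set D \<longleftrightarrow>
     (\<exists>l::nat. \<forall>g. g \<noteq> 0 \<longrightarrow> card {(x, y). x \<in> D \<and> y \<in> D \<and> x - y = g} = l)"

definition skew_hadamard_difference_set :: "'g::{ab_group_add,finite} set \<Rightarrow> bool" where
  "skew_hadamard_difference_set D \<longleftrightarrow>
     odd CARD('g) \<and> difference_set D \<and>
     D \<inter> uminus ` D = {} \<and> 0 \<notin> D \<and> 0 \<notin> uminus ` D \<and>
     D \<union> uminus ` D \<union> {0} = UNIV"

text \<open>The parameters \<open>(v, (v-1)/2, (v-5)/4, (v-1)/4)\<close>, with the divisions required to be exact.\<close>

definition paley_type_pds :: "'g::{ab_group_add,finite} set \<Rightarrow> bool" where
  "paley_type_pds D \<longleftrightarrow>
     odd CARD('g) \<and>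
     (\<exists>v \<kappa> l \<mu>. srg (cayley_graph D) v \<kappa> l \<mu> \<and>
        2 * \<kappa> + 1 = v \<and> 4 * l + 5 = v \<and> 4 * \<mu> + 1 = v)"

end

(*
  Let B = +-p^(s*theta) be the constant with G(chi^j) = B * sum_{z in L_i} chi(z)^j for j = 1.
  This identity holds for every j not divisible by k: since chi is trivial on the prime field, it
  is (after multiplication by p - 1) an integral polynomial relation for chi(gamma), and such
  relations between roots of unity persist under z -> z^j for j coprime to k.  Fourier inversion
  turns it into: psi(b C_0) = A + B [b in L_i C_0] for a constant A.

  For x <> 0, x lies in D iff eta(x) = 1 - 2 [1/x in L_i C_0], where eta is the quadratic
  character.  Hence psi(aD) is governed by sum_x eta(x) psi(ax) psi(x^-1 C_0), a sum over c in C_0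
  of the Salie sums sum_x eta(x) psi(ax + c/x) = eta(a) G(eta) sum_{y^2 = 4ac} psi(y).  As k is odd,
  the y with y^2 in 4a C_0 form a single class b C_0, and the total is eta(a) G(eta) psi(b C_0).
  Thus psi(aD) = (-1 +- G(eta)) / 2, and G(eta)^2 = eta(-1) q.  The Salie evaluation takes the
  place of the Davenport-Hasse product formula.
*)

theory Submission
  imports Defs "HOL-Computational_Algebra.Field_as_Ring" "Jordan_Normal_Form.Char_Poly"
begin

text \<open>Conjugation z -> z^j reaches only the exponents j coprime to k. If j shares a factor
  with k without being divisible by it, \<chi>^j has smaller order and is not a conjugate of \<chi>;
  for these j the identity is supplied by the hypothesis \<open>gauss_lower_order\<close>. All
  nontrivial powers matter, because recovering a class sum means inverting over the whole group of
  characters trivial on C_0. The shape of J comes from the Chinese remainder theorem: k is odd, so a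
  class of order 2k amounts to a class of order k together with a parity, and the parity is the
  value of \<eta>. From each class of order k, D takes exactly one half, the nonsquares over the
  inverses of L_i and the squares elsewhere. Inverses enter because the sum of \<psi>(c/x) over c in
  C_0 is the class sum of 1/x. This is what couples membership of x in D to the term c/x of a Salie
  sum. The constant A cancels between the two sides and B can be divided out, so neither has to be
  known; the sign of G(\<eta>) stays undetermined as well, since the conclusion allows both
  signs.\<close>

section \<open>Integral relations between roots of unity\<close>

text \<open>Multiplication by \<open>p(w)\<close> acts on the vector \<open>(1, w, \<dots>, w\<^bsup>k-1\<^esup>)\<close> through an integer matrix.\<close>

lemma algebraic_int_poly_root_of_unity:
  fixes w :: complex and p :: "int poly"
  assumes "k > 0" and w: "w ^ k = 1"
  shows "algebraic_int (poly (of_int_poly p) w)"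
proof -
  define z where "z = poly (of_int_poly p) w"
  define M :: "int mat" where
    "M = mat k k (\<lambda>(i, j). \<Sum>n | n \<le> degree p \<and> (n + i) mod k = j. Polynomial.coeff p n)"
  define v where "v = vec k (\<lambda>i. w ^ i)"
  have wmod: "w ^ (n mod k) = w ^ n" for n
  proof -
    have "w ^ n = w ^ (k * (n div k) + n mod k)" by simp
    also have "\<dots> = w ^ (n mod k)" by (simp only: power_add power_mult w power_one mult_1_left)
    finally show ?thesis by simp
  qed
  have "map_mat of_int M *\<^sub>v v = z \<cdot>\<^sub>v v"
  proof (rule eq_vecI)
    fix i assume "i < dim_vec (z \<cdot>\<^sub>v v)"
    hence i: "i < k" by (simp add: v_def)
    have "(map_mat of_int M *\<^sub>v v) $ i =
        (\<Sum>j<k. \<Sum>n | n \<in> {..degree p} \<and> (n + i) mod k = j. of_int (Polynomial.coeff p n) * w ^ ((n + i) mod k))"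
      using i by (simp add: M_def v_def scalar_prod_def sum_distrib_right atLeast0LessThan)
    also have "\<dots> = (\<Sum>n\<le>degree p. of_int (Polynomial.coeff p n) * w ^ ((n + i) mod k))"
      using \<open>k > 0\<close> by (intro sum.group) auto
    also have "\<dots> = z * w ^ i"
      by (simp add: z_def wmod poly_altdef sum_distrib_left power_add mult_ac)
    finally show "(map_mat of_int M *\<^sub>v v) $ i = (z \<cdot>\<^sub>v v) $ i"
      using i by (simp add: v_def)
  qed (simp add: M_def v_def)
  moreover have "v \<noteq> 0\<^sub>v k"
  proof
    assume "v = 0\<^sub>v k"
    hence "v $ 0 = 0\<^sub>v k $ 0" by simp
    thus False using \<open>k > 0\<close> by (simp add: v_def)
  qed
  ultimately have "eigenvalue (map_mat complex_of_int M) z"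
    by (auto simp: eigenvalue_def eigenvector_def M_def v_def intro!: exI[of _ v])
  hence "poly (char_poly (map_mat complex_of_int M)) z = 0"
    by (subst (asm) eigenvalue_root_char_poly[of _ k]) (auto simp: M_def)
  moreover have "char_poly (map_mat complex_of_int M) = of_int_poly (char_poly M)"
    by (rule of_int_hom.char_poly_hom[of _ k]) (simp add: M_def)
  moreover have "lead_coeff (char_poly M) = 1"
    using degree_monic_char_poly[of M k] by (simp add: M_def)
  ultimately show ?thesis
    unfolding z_def[symmetric] algebraic_int_altdef_ipoly by auto
qed

lemma prime_not_dvd_imp_not_algebraic_int:
  fixes l k :: nat
  assumes "prime l" "\<not> l dvd k"
  shows "\<not> algebraic_int (of_nat k / of_nat l :: complex)"
proof
  assume "algebraic_int (of_nat k / of_nat l :: complex)"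
  hence "(of_nat k / of_nat l :: complex) \<in> \<int>"
    by (rule rational_algebraic_int_is_int) auto
  then obtain n where "(of_nat k / of_nat l :: complex) = of_int n" by (auto elim: Ints_cases)
  hence "complex_of_int (int k) = of_int (n * int l)"
    using assms(1) by (simp add: field_simps prime_gt_0_nat)
  hence "int k = n * int l" by (simp only: of_int_eq_iff)
  hence "int l dvd int k" by simp
  thus False using assms(2) by simp
qed

text \<open>Frobenius in F_l[X]: the mixed binomial terms of (a + X p)^l are divisible by l, and
  constants are fixed by Fermat's little theorem. The multiple of l is kept as an explicit
  polynomial so that the congruence can be evaluated at a complex number.\<close>

lemma poly_power_prime:
  fixes p :: "int poly"
  assumes l: "prime l"
  shows "\<exists>r. p ^ l = pcompose p (Polynomial.monom 1 l) + of_nat l * r"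
proof (induction p)
  case 0
  show ?case using l by (intro exI[of _ 0]) (simp add: prime_gt_0_nat power_0_left)
next
  case (pCons a p)
  then obtain r where r: "p ^ l = pcompose p (Polynomial.monom 1 l) + of_nat l * r" by blast
  have 1: "\<exists>t. (x + y) ^ l = x ^ l + y ^ l + of_nat l * t" for x y :: "int poly"
  proof -
    have "l > 0" using l by (simp add: prime_gt_0_nat)
    have "(x + y) ^ l = (\<Sum>k\<le>l. of_nat (l choose k) * x ^ k * y ^ (l - k))"
      by (rule binomial_ring)
    also have "{..l} = insert 0 (insert l {0<..<l})" using \<open>l > 0\<close> by auto
    also have "(\<Sum>k\<in>insert 0 (insert l {0<..<l}). of_nat (l choose k) * x ^ k * y ^ (l - k))
       = y ^ l + x ^ l + (\<Sum>k\<in>{0<..<l}. of_nat (l choose k) * x ^ k * y ^ (l - k))"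
      using \<open>l > 0\<close> by simp
    also have "(\<Sum>k\<in>{0<..<l}. of_nat (l choose k) * x ^ k * y ^ (l - k)) =
       (\<Sum>k\<in>{0<..<l}. of_nat l * (of_nat ((l choose k) div l) * x ^ k * y ^ (l - k)))"
    proof (rule sum.cong[OF refl])
      fix k assume "k \<in> {0<..<l}"
      hence "l dvd (l choose k)" using l by (intro dvd_choose_prime) auto
      then obtain c where c: "l choose k = l * c" by blast
      thus "of_nat (l choose k) * x ^ k * y ^ (l - k) =
        of_nat l * (of_nat ((l choose k) div l) * x ^ k * y ^ (l - k))"
        using \<open>l > 0\<close> by (simp add: mult_ac)
    qed
    also have "\<dots> = of_nat l * (\<Sum>k\<in>{0<..<l}. of_nat ((l choose k) div l) * x ^ k * y ^ (l - k))"
      by (rule sum_distrib_left[symmetric])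
    finally show ?thesis by (auto simp: add_ac)
  qed
  obtain t where t: "([:a:] + [:0,1:] * p) ^ l = [:a:] ^ l + ([:0,1:] * p) ^ l + of_nat l * t"
    using 1 by blast
  have "[a ^ l = a] (mod int l)"
  proof (cases "int l dvd a")
    case True
    moreover have "a dvd a ^ l" using l by (simp add: prime_gt_0_nat dvd_power)
    ultimately show ?thesis by (meson cong_0_iff cong_sym cong_trans dvd_trans)
  next
    case False
    \<comment> \<open>Fermat's theorem is applied over the naturals, so the integer \<open>a\<close>
      is replaced by its least nonnegative residue.\<close>
    define b where "b = nat (a mod int l)"
    have b: "[int b = a] (mod int l)" using l by (simp add: b_def cong_def prime_gt_0_nat)
    have "\<not> l dvd b" using False b by (metis cong_dvd_iff int_dvd_int_iff cong_sym of_nat_dvd_iff)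
    hence "[b ^ (l - 1) = 1] (mod l)" using l by (rule fermat_theorem[rotated])
    hence "[b ^ (l - 1) * b = 1 * b] (mod l)" by (rule cong_mult) simp
    hence "[b ^ l = b] (mod l)" using l
      by (metis Suc_diff_1 mult_1 power_Suc2 prime_gt_0_nat)
    hence "[int b ^ l = int b] (mod int l)" by (metis cong_int_iff of_nat_power)
    thus ?thesis using b by (meson cong_pow cong_sym cong_trans)
  qed
  then obtain c where c: "a ^ l = a + int l * c" by (metis cong_iff_lin cong_sym)
  have "pCons a p ^ l = ([:a:] + [:0,1:] * p) ^ l" by simp
  also have "\<dots> = [:a ^ l:] + [:0,1:] ^ l * p ^ l + of_nat l * t"
    by (simp only: t power_mult_distrib poly_const_pow)
  also have "[:0,1:] ^ l = Polynomial.monom (1::int) l" by (simp add: monom_altdef)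
  also have "[:a ^ l:] + Polynomial.monom 1 l * p ^ l + of_nat l * t =
     pcompose (pCons a p) (Polynomial.monom 1 l) + of_nat l * ([:c:] + Polynomial.monom 1 l * r + t)"
    by (simp add: r c pcompose_pCons algebra_simps of_nat_poly)
  finally show ?case by blast
qed


section \<open>Integrality of monic divisors of X^k - 1\<close>

lemma coeff_prod_linear_factors_in_ring:
  fixes R :: "'a::comm_ring_1 set"
  assumes "finite A" "A \<subseteq> R" "0 \<in> R" "1 \<in> R" "\<And>x. x \<in> R \<Longrightarrow> - x \<in> R"
    "\<And>x y. x \<in> R \<Longrightarrow> y \<in> R \<Longrightarrow> x + y \<in> R" "\<And>x y. x \<in> R \<Longrightarrow> y \<in> R \<Longrightarrow> x * y \<in> R"
  shows "Polynomial.coeff (\<Prod>z\<in>A. [:- z, 1:]) i \<in> R"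
  using assms(1,2)
proof (induction A arbitrary: i)
  case empty
  show ?case using assms(3,4) by (simp add: coeff_1)
next
  case (insert z A)
  have "Polynomial.coeff (\<Prod>z\<in>insert z A. [:- z, 1:]) i =
     - z * Polynomial.coeff (\<Prod>z\<in>A. [:- z, 1:]) i +
     (case i of 0 \<Rightarrow> 0 | Suc j \<Rightarrow> Polynomial.coeff (\<Prod>z\<in>A. [:- z, 1:]) j)"
    using insert.hyps by (simp add: coeff_pCons mult_pCons_left split: nat.splits)
  also have "\<dots> \<in> R"
  proof (cases i)
    case (Suc j)
    have "- z * Polynomial.coeff (\<Prod>z\<in>A. [:- z, 1:]) i + Polynomial.coeff (\<Prod>z\<in>A. [:- z, 1:]) j \<in> R"
      using insert.prems by (intro assms insert.IH) auto
    thus ?thesis using Suc by simp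
  next
    case 0
    have "- z * Polynomial.coeff (\<Prod>z\<in>A. [:- z, 1:]) i \<in> R"
      using insert.prems by (intro assms insert.IH) auto
    thus ?thesis using 0 by simp
  qed
  finally show ?case .
qed

text \<open>X^k - 1 and its derivative have no common root, so \<open>F\<close> is a product of
  distinct factors X - w^n and its coefficients lie in Z[w], realised as the values at w of integer
  polynomials. For rational \<open>F\<close> this plays the part of Gauss's lemma.\<close>

lemma monic_divisor_coeff_algebraic_int:
  fixes F G :: "complex poly"
  assumes "k > 0" and FG: "F * G = Polynomial.monom 1 k - 1" and lc: "lead_coeff F = 1"
  shows "algebraic_int (Polynomial.coeff F i)"
proof -
  define w where "w = cis (2 * pi / real k)"
  define R where "R = range (\<lambda>p. poly (of_int_poly p) w)"
  have w: "w ^ k = 1" using \<open>k > 0\<close> by (simp add: w_def DeMoivre)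
  have FGp: "poly F z * poly G z = z ^ k - 1" for z
    using arg_cong[OF FG, of "\<lambda>p. poly p z"] by (simp add: poly_monom)
  have "rsquarefree F"
    unfolding rsquarefree_roots
  proof (intro allI notI, elim conjE)
    fix a assume a: "poly F a = 0" "poly (pderiv F) a = 0"
    hence "a ^ k = 1" using FGp[of a] by simp
    hence "a \<noteq> 0" using \<open>k > 0\<close> by (auto simp: power_0_left)
    have "poly (pderiv (F * G)) a = 0" using a by (simp add: pderiv_mult)
    hence "of_nat k * a ^ (k - 1) = 0"
      by (simp add: FG pderiv_diff pderiv_monom poly_monom)
    thus False using \<open>a \<noteq> 0\<close> \<open>k > 0\<close> by simp
  qed
  hence F: "(\<Prod>z | poly F z = 0. [:- z, 1:]) = F"
    using complex_poly_decompose_rsquarefree[of F] lc by simp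
  have "F \<noteq> 0" using lc by auto
  have sub: "{z. poly F z = 0} \<subseteq> R"
  proof
    fix z assume "z \<in> {z. poly F z = 0}"
    hence "z ^ k = 1" using FGp[of z] by simp
    then obtain n where "z = cis (2 * pi * real n / real k)"
      using bij_betw_roots_unity[OF \<open>k > 0\<close>] by (auto simp: bij_betw_def)
    hence "z = w ^ n" by (simp add: w_def DeMoivre mult_ac)
    hence "z = poly (of_int_poly (Polynomial.monom 1 n)) w"
      by (simp add: poly_monom map_poly_monom)
    thus "z \<in> R" unfolding R_def by blast
  qed
  have "Polynomial.coeff (\<Prod>z | poly F z = 0. [:- z, 1:]) i \<in> R"
  proof (rule coeff_prod_linear_factors_in_ring)
    show "finite {z. poly F z = 0}" using \<open>F \<noteq> 0\<close> by (rule poly_roots_finite)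
    show "0 \<in> R" unfolding R_def by (rule range_eqI[of _ _ 0]) simp
    show "1 \<in> R" unfolding R_def by (rule range_eqI[of _ _ 1]) simp
    show "- x \<in> R" if "x \<in> R" for x
    proof -
      from that obtain p where "x = poly (of_int_poly p) w" by (auto simp: R_def)
      thus ?thesis unfolding R_def by (intro range_eqI[of _ _ "- p"]) (simp add: hom_distribs)
    qed
    fix x y assume "x \<in> R" "y \<in> R"
    then obtain p r where pr: "x = poly (of_int_poly p) w" "y = poly (of_int_poly r) w"
      by (auto simp: R_def)
    show "x + y \<in> R"
      unfolding R_def by (rule range_eqI[of _ _ "p + r"]) (simp add: pr hom_distribs)
    show "x * y \<in> R"
      unfolding R_def by (rule range_eqI[of _ _ "p * r"]) (simp add: pr hom_distribs)
  qed (fact sub)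
  thus ?thesis
    unfolding F R_def using algebraic_int_poly_root_of_unity[OF \<open>k > 0\<close> w] by auto
qed

text \<open>Let \<open>F\<close> be the monic gcd of \<open>h\<close> and \<open>X\<^sup>k - 1 = F G\<close>. If \<open>F\<close> did not vanish at \<open>y = z\<^sup>l\<close>, then
  \<open>G(y) = 0\<close>, so differentiating gives \<open>k y\<^bsup>k-1\<^esup> = F(y) G'(y)\<close>; but \<open>F(y) \<equiv> F(z)\<^sup>l = 0\<close> modulo \<open>l\<close>,
  and \<open>k / l\<close> would be an algebraic integer.\<close>

lemma int_poly_root_of_unity_power_prime:
  fixes h :: "int poly" and z :: complex
  assumes "k > 0" and z: "z ^ k = 1" and h: "poly (of_int_poly h) z = 0"
    and l: "prime l" "\<not> l dvd k"
  shows "poly (of_int_poly h) (z ^ l) = 0"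
proof -
  define P :: "rat poly" where "P = Polynomial.monom 1 k - 1"
  define H :: "rat poly" where "H = of_int_poly h"
  define f where "f = gcd H P"
  define e where "e = lead_coeff f"
  have "P \<noteq> 0"
  proof
    assume "P = 0"
    hence "Polynomial.coeff P k = 0" by simp
    thus False using \<open>k > 0\<close> by (simp add: P_def coeff_1)
  qed
  hence e: "e \<noteq> 0" by (simp add: e_def f_def)
  \<comment> \<open>Bezout makes the common root z of h and X^k - 1 a root of the gcd; conversely
    the gcd divides h, which carries a root at z^l back to h at the end.\<close>
  obtain a b where ab: "a * H + b * P = f" unfolding f_def by (metis bezout_coefficients prod.collapse)
  obtain c d where cd: "P = f * c" "H = f * d" unfolding f_def by (meson dvdE gcd_dvd1 gcd_dvd2)
  interpret of_rat_poly: map_poly_idom_hom "of_rat :: rat \<Rightarrow> complex" ..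
  let ?C = "map_poly of_rat :: rat poly \<Rightarrow> complex poly"
  \<comment> \<open>Moving the leading coefficient \<open>e\<close> from one factor to the other
    makes both monic. Their rational coefficients are then algebraic integers, hence integers, which
    yields \<open>f0\<close> and \<open>g0\<close>.\<close>
  define F where "F = ?C (Polynomial.smult (1 / e) f)"
  define G where "G = ?C (Polynomial.smult e c)"
  have CH: "?C H = of_int_poly h"
    by (intro poly_eqI) (simp add: H_def coeff_map_poly)
  have CP: "?C P = Polynomial.monom 1 k - 1"
    by (intro poly_eqI) (simp add: P_def coeff_map_poly of_rat_diff coeff_1)
  have FG: "F * G = Polynomial.monom 1 k - 1"
    using e by (simp add: F_def G_def hom_distribs cd(1) flip: CP)
  have lcF: "lead_coeff F = 1"
    using e by (simp add: F_def e_def)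
  have "lead_coeff (F * G) = 1"
  proof -
    have "Polynomial.degree (Polynomial.monom 1 k - 1 :: complex poly) = k"
      using \<open>k > 0\<close> by (subst diff_conv_add_uminus, subst degree_add_eq_left) (auto simp: degree_monom_eq)
    thus ?thesis using \<open>k > 0\<close> by (simp add: FG coeff_1)
  qed
  hence lcG: "lead_coeff G = 1" using lcF by (simp add: lead_coeff_mult)
  have "Polynomial.coeff F i \<in> \<int>" for i
    using monic_divisor_coeff_algebraic_int[OF \<open>k > 0\<close> FG lcF, of i]
    by (rule rational_algebraic_int_is_int) (simp add: F_def coeff_map_poly)
  then obtain f0 where f0: "F = of_int_poly f0" by (rule intpolyE)
  have "Polynomial.coeff G i \<in> \<int>" for i
    using monic_divisor_coeff_algebraic_int[OF \<open>k > 0\<close> _ lcG, of F i] FG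
    by (intro rational_algebraic_int_is_int) (simp_all add: G_def coeff_map_poly mult_ac)
  then obtain g0 where g0: "G = of_int_poly g0" by (rule intpolyE)
  have FGp: "poly F y * poly G y = y ^ k - 1" for y
    using arg_cong[OF FG, of "\<lambda>p. poly p y"] by (simp add: poly_monom)
  have "poly (?C f) z = 0"
    using h z by (simp add: hom_distribs CH CP poly_monom flip: ab)
  hence Fz: "poly F z = 0" by (simp add: F_def hom_distribs)
  define y where "y = z ^ l"
  have yk: "y ^ k = 1" using z by (simp add: y_def mult.commute flip: power_mult) (simp add: power_mult)
  hence "y \<noteq> 0" using \<open>k > 0\<close> by (auto simp: power_0_left)
  have "poly F y = 0"
  proof (rule ccontr)
    assume "poly F y \<noteq> 0"
    hence "poly G y = 0" using FGp[of y] yk by simp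
    hence "poly (pderiv (F * G)) y = poly F y * poly (pderiv G) y" by (simp add: pderiv_mult)
    hence 1: "of_nat k * y ^ (k - 1) = poly F y * poly (pderiv G) y"
      by (simp add: FG pderiv_diff pderiv_monom poly_monom)
    obtain r where r: "f0 ^ l = pcompose f0 (Polynomial.monom 1 l) + of_nat l * r"
      using poly_power_prime[OF l(1)] by blast
    have "poly F z ^ l = poly F y + of_nat l * poly (of_int_poly r) z"
      using arg_cong[OF r, of "\<lambda>p. poly (of_int_poly p) z"]
      by (simp add: hom_distribs f0 y_def poly_pcompose poly_monom of_int_hom.map_poly_pcompose map_poly_monom)
    hence Fy: "poly F y = - of_nat l * poly (of_int_poly r) z"
      using Fz l(1) by (simp add: power_0_left prime_gt_0_nat eq_neg_iff_add_eq_0)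
    \<comment> \<open>The value of \<open>t\<close> at z is k / l. Composing with X^l expresses
      G'(y) through z, and the last factor X^l is the extra y that completes y^(k-1) to y^k =
      1.\<close>
    define t where "t = - r * pcompose (pderiv g0) (Polynomial.monom 1 l) * Polynomial.monom 1 l"
    have "of_nat k = of_nat k * y ^ (k - 1) * y" using yk \<open>k > 0\<close>
      by (metis mult.assoc mult.right_neutral power_minus_mult)
    also have "\<dots> = of_nat l * poly (of_int_poly t) z"
      unfolding 1 Fy g0 t_def
      by (simp add: hom_distribs y_def poly_pcompose poly_monom of_int_hom.map_poly_pcompose map_poly_monom
          of_int_hom.map_poly_pderiv)
    finally have "of_nat k / of_nat l = poly (of_int_poly t) z"
      using l(1) by (simp add: field_simps prime_gt_0_nat)
    hence "algebraic_int (of_nat k / of_nat l :: complex)"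
      using algebraic_int_poly_root_of_unity[OF \<open>k > 0\<close> z] by simp
    thus False using prime_not_dvd_imp_not_algebraic_int[OF l] by blast
  qed
  hence "poly (?C f) y = 0" using e by (simp add: F_def hom_distribs)
  thus ?thesis unfolding y_def[symmetric] CH[symmetric] cd(2) by (simp add: hom_distribs)
qed

text \<open>Prime factors of j are peeled off one at a time, z^l being again a k-th root of unity.
  This is invariance of rational relations under Galois conjugation, obtained without the
  irreducibility of cyclotomic polynomials.\<close>

lemma int_poly_root_of_unity_power_coprime:
  fixes h :: "int poly" and z :: complex
  assumes "k > 0" "z ^ k = 1" "poly (of_int_poly h) z = 0" "coprime j k" "j > 0"
  shows "poly (of_int_poly h) (z ^ j) = 0"
  using assms(2-5)
proof (induction j arbitrary: z rule: less_induct)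
  case (less j)
  show ?case
  proof (cases "j = 1")
    case False
    then obtain l where l: "prime l" "l dvd j" using prime_factor_nat by blast
    then obtain i where i: "j = l * i" by blast
    have "\<not> l dvd k" using l less.prems(3) by (metis coprime_def not_prime_unit)
    hence "poly (of_int_poly h) (z ^ l) = 0"
      using int_poly_root_of_unity_power_prime[OF \<open>k > 0\<close>] less.prems l by blast
    moreover have "(z ^ l) ^ k = 1"
      using less.prems(1) by (metis mult.commute power_mult power_one)
    moreover have "i < j" using i l(1) less.prems(4) by (simp add: prime_gt_Suc_0_nat)
    ultimately show ?thesis
      using less.IH[of i "z ^ l"] less.prems i by (simp add: power_mult)
  qed (use less.prems in simp)
qed

section \<open>Additive characters\<close>

lemma ff_degree_eq:
  assumes "CARD('a::finite_field) = CHAR('a) ^ n"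
  shows "ff_degree TYPE('a) = n"
  unfolding ff_degree_def assms
  using prime_gt_1_nat[OF CHAR_prime[where ?'a = 'a]] by (intro the_equality) auto

lemma abs_trace_add: "abs_trace (x + y) = abs_trace x + abs_trace (y :: 'a::finite_field)"
  unfolding abs_trace_def by (simp add: freshmans_dream'[OF CHAR_prime refl] sum.distrib)

text \<open>Frobenius permutes the summands cyclically: the shifted sum gains x^(p^n) = x and loses
  x.\<close>

lemma abs_trace_power_CHAR:
  fixes x :: "'a::finite_field"
  assumes card: "CARD('a) = CHAR('a) ^ n"
  shows "abs_trace x ^ CHAR('a) = abs_trace x"
proof -
  have n: "ff_degree TYPE('a) = n" by (rule ff_degree_eq[OF card])
  have "abs_trace x ^ CHAR('a) = (\<Sum>i<n. x ^ (CHAR('a) ^ Suc i))"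
    unfolding abs_trace_def n
    by (subst freshmans_dream_sum[OF CHAR_prime refl]) (simp add: mult.commute flip: power_mult)
  also have "\<dots> = (\<Sum>i<Suc n. x ^ (CHAR('a) ^ i)) - x"
    by (subst sum.lessThan_Suc_shift) simp
  also have "\<dots> = (\<Sum>i<n. x ^ (CHAR('a) ^ i))"
    using finite_field_power_card_eq_same[of x] by (simp add: card)
  finally show ?thesis by (simp add: abs_trace_def n)
qed

lemma of_nat_power_CHAR: "(of_nat t :: 'a::finite_field) ^ CHAR('a) = of_nat t"
proof (induction t)
  case (Suc t)
  thus ?case using freshmans_dream[of "CHAR('a)" "1 :: 'a" "of_nat t"] by simp
qed (simp add: power_0_left)

text \<open>X^p - X has at most p roots, and the p elements of the prime field already account for
  all of them.\<close>

lemma power_CHAR_fixed_imp_of_nat: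
  fixes y :: "'a::finite_field"
  assumes "y ^ CHAR('a) = y"
  obtains t where "y = of_nat t"
proof -
  define p where "p = CHAR('a)"
  have p: "p > 1" using prime_gt_1_nat[OF CHAR_prime[where ?'a = 'a]] by (simp add: p_def)
  define P :: "'a poly" where "P = Polynomial.monom 1 p - [:0, 1:]"
  have "Polynomial.coeff P p = 1" using p by (simp add: P_def coeff_pCons split: nat.splits)
  hence "P \<noteq> 0" by auto
  have "degree P \<le> p"
    unfolding P_def using p by (intro degree_diff_le degree_monom_le) simp
  have P: "poly P x = x ^ p - x" for x by (simp add: P_def poly_monom)
  have sub: "of_nat ` {..<p} \<subseteq> {x. poly P x = 0}" by (auto simp: P p_def of_nat_power_CHAR)
  have "inj_on (of_nat :: nat \<Rightarrow> 'a) {..<p}"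
    by (intro inj_onI) (simp add: of_nat_eq_iff_cong_CHAR p_def cong_def)
  hence "card ((of_nat :: nat \<Rightarrow> 'a) ` {..<p}) = p" by (simp add: card_image)
  moreover have "card {x. poly P x = 0} \<le> p"
    using poly_roots_degree[OF \<open>P \<noteq> 0\<close>] \<open>degree P \<le> p\<close> by linarith
  ultimately have "of_nat ` {..<p} = {x. poly P x = 0}"
    by (intro card_seteq sub) (simp_all add: poly_roots_finite[OF \<open>P \<noteq> 0\<close>])
  moreover have "y \<in> {x. poly P x = 0}" using assms by (simp add: P p_def)
  ultimately show ?thesis using that by blast
qed

text \<open>The trace is a polynomial of degree at most p^(n-1), nonzero because its coefficient at
  X is 1, so it has too few roots to vanish on all p^n elements.\<close>

lemma abs_trace_nontrivial:
  assumes card: "CARD('a::finite_field) = CHAR('a) ^ n"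
  shows "\<exists>x::'a. abs_trace x \<noteq> 0"
proof (rule ccontr)
  assume "\<not> ?thesis"
  hence zero: "abs_trace x = 0" for x :: 'a by blast
  define p where "p = CHAR('a)"
  have p: "p > 1" using prime_gt_1_nat[OF CHAR_prime[where ?'a = 'a]] by (simp add: p_def)
  have "card {0, 1 :: 'a} \<le> CARD('a)" by (rule card_mono) auto
  hence "n > 0" using card by (intro Nat.gr0I) simp
  define P :: "'a poly" where "P = (\<Sum>i<n. Polynomial.monom 1 (p ^ i))"
  have "Polynomial.coeff P 1 = (\<Sum>i<n. if i = 0 then 1 else 0)"
    unfolding P_def coeff_sum using p by (intro sum.cong) auto
  also have "\<dots> = 1" using \<open>n > 0\<close> by simp
  finally have "P \<noteq> 0" by auto
  have "degree P \<le> p ^ (n - 1)"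
    unfolding P_def
  proof (rule degree_sum_le)
    fix i assume "i \<in> {..<n}"
    hence "p ^ i \<le> p ^ (n - 1)" using p by (intro power_increasing) auto
    thus "degree (Polynomial.monom (1::'a) (p ^ i)) \<le> p ^ (n - 1)"
      by (meson degree_monom_le le_trans)
  qed simp
  also have "\<dots> < p ^ n" using p \<open>n > 0\<close> by simp
  finally have "degree P < CARD('a)" by (simp add: card p_def)
  moreover have "{x. poly P x = 0} = UNIV"
    using zero by (auto simp: P_def poly_sum poly_monom abs_trace_def ff_degree_eq[OF card] p_def)
  ultimately show False using poly_roots_degree[OF \<open>P \<noteq> 0\<close>] by simp
qed

text \<open>The least representative in the definition may be replaced by any other, since two of
  them differ by a multiple of p. Additivity of the character can then be checked on t1 + t2 without
  reducing modulo p.\<close>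

lemma canonical_char_eq:
  assumes "of_nat t = abs_trace (x :: 'a::finite_field)"
  shows "canonical_char x = cis (2 * pi * real t / real CHAR('a))"
proof -
  define p where "p = CHAR('a)"
  have p: "p > 0" by (simp add: p_def)
  define s where "s = (LEAST t. of_nat t = abs_trace x)"
  have "of_nat s = abs_trace x" unfolding s_def using assms by (rule LeastI)
  hence "s mod p = t mod p" using assms by (metis of_nat_eq_iff_cong_CHAR cong_def p_def)
  have "cis (2 * pi * real u / real p) = cis (2 * pi * real (u mod p) / real p)" for u
  proof -
    have "real u = real p * real (u div p) + real (u mod p)" by (metis mult_div_mod_eq of_nat_add of_nat_mult)
    hence "2 * pi * real u / real p = 2 * pi * real (u div p) + 2 * pi * real (u mod p) / real p"
      using p by (simp add: field_simps)
    moreover have "cis (2 * pi * real (u div p)) = 1" by (rule cis_multiple_2pi) simp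
    ultimately show ?thesis by (simp flip: cis_mult)
  qed
  thus ?thesis using \<open>s mod p = t mod p\<close> unfolding canonical_char_def s_def[symmetric] p_def by metis
qed

text \<open>All later sums use the canonical character only through these three properties. That its
  values are p-th roots of unity also follows from them, by \<open>psi_of_nat_mult\<close>.\<close>

locale additive_character =
  fixes \<psi> :: "'a::finite_field \<Rightarrow> complex"
  assumes psi_add: "\<psi> (x + y) = \<psi> x * \<psi> y"
    and psi_0: "\<psi> 0 = 1"
    and psi_nontrivial: "\<exists>x. \<psi> x \<noteq> 1"

lemma additive_character_canonical_char:
  assumes card: "CARD('a::finite_field) = CHAR('a) ^ n"
  shows "additive_character (canonical_char :: 'a \<Rightarrow> complex)"
proof
  define p where "p = CHAR('a)"
  have p: "p > 0" by (simp add: p_def)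
  have ex: "\<exists>t. of_nat t = abs_trace x" for x :: 'a
    using power_CHAR_fixed_imp_of_nat[OF abs_trace_power_CHAR[OF card]] by metis
  show "canonical_char (x + y) = canonical_char x * canonical_char y" for x y :: 'a
  proof -
    obtain s t where st: "of_nat s = abs_trace x" "of_nat t = abs_trace y" using ex by metis
    have "of_nat (s + t) = abs_trace (x + y)" by (simp add: st abs_trace_add)
    note this[THEN canonical_char_eq] st[THEN canonical_char_eq]
    thus ?thesis by (simp add: cis_mult add_divide_distrib distrib_left)
  qed
  have "abs_trace 0 + abs_trace 0 = abs_trace (0::'a) + 0" using abs_trace_add[of 0 "0::'a"] by simp
  hence "of_nat 0 = abs_trace (0::'a)" by (simp only: add_left_cancel of_nat_0)
  from canonical_char_eq[OF this] show "canonical_char (0::'a) = 1" by simp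
  obtain x :: 'a where x: "abs_trace x \<noteq> 0" using abs_trace_nontrivial[OF card] by blast
  obtain t where t: "of_nat t = abs_trace x" using ex by blast
  hence t': "of_nat (t mod p) = abs_trace x" by (metis of_nat_eq_iff_cong_CHAR cong_def mod_mod_trivial p_def)
  hence "t mod p \<noteq> 0" using x by (intro notI) simp
  have "cis (2 * pi * real (t mod p) / real p) \<noteq> 1"
  proof
    assume "cis (2 * pi * real (t mod p) / real p) = 1"
    also have "1 = cis (2 * pi * real 0 / real p)" by simp
    finally show False
      using \<open>t mod p \<noteq> 0\<close> p inj_onD[OF bij_betw_imp_inj_on[OF bij_betw_roots_unity[OF p]], of "t mod p" 0]
      by auto
  qed
  thus "\<exists>x::'a. canonical_char x \<noteq> 1" using canonical_char_eq[OF t'] unfolding p_def by metis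
qed

section \<open>Orthogonality and Fourier inversion on the additive group\<close>

context additive_character
begin

lemma psi_of_nat_mult: "\<psi> (of_nat n * x) = \<psi> x ^ n"
  by (induction n) (simp_all add: psi_0 psi_add algebra_simps)

lemma sum_psi: "(\<Sum>x\<in>UNIV. \<psi> (a * x)) = (if a = 0 then of_nat CARD('a) else 0)"
proof (cases "a = 0")
  case False
  obtain y where y: "\<psi> y \<noteq> 1" using psi_nontrivial by blast
  have "\<psi> y * (\<Sum>x\<in>UNIV. \<psi> (a * x)) = (\<Sum>x\<in>UNIV. \<psi> (a * (x + y / a)))"
    using False by (simp add: sum_distrib_left algebra_simps psi_add)
  also have "\<dots> = (\<Sum>x\<in>UNIV. \<psi> (a * x))"
    by (rule sum.reindex_bij_witness[of _ "\<lambda>x. x - y / a" "\<lambda>x. x + y / a"]) auto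
  finally show ?thesis using y False by simp
qed (simp add: psi_0)

lemma sum_psi_nonzero: "a \<noteq> 0 \<Longrightarrow> (\<Sum>x\<in>UNIV - {0}. \<psi> (a * x)) = -1"
  using sum_psi[of a] sum.remove[of UNIV 0 "\<lambda>x. \<psi> (a * x)"] by (simp add: psi_0 eq_neg_iff_add_eq_0 add.commute)

lemma fourier_inversion:
  "of_nat CARD('a) * F g = (\<Sum>a\<in>UNIV. \<psi> (- (a * g)) * (\<Sum>x\<in>UNIV. F x * \<psi> (a * x)))"
proof -
  have "(\<Sum>a\<in>UNIV. \<psi> (- (a * g)) * (\<Sum>x\<in>UNIV. F x * \<psi> (a * x)))
      = (\<Sum>a\<in>UNIV. \<Sum>x\<in>UNIV. F x * \<psi> ((x - g) * a))"
    by (simp add: sum_distrib_left algebra_simps flip: psi_add)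
  also have "\<dots> = (\<Sum>x\<in>UNIV. F x * (\<Sum>a\<in>UNIV. \<psi> ((x - g) * a)))"
    by (subst sum.swap) (simp add: sum_distrib_left)
  also have "\<dots> = (\<Sum>x\<in>UNIV. if x = g then of_nat CARD('a) * F x else 0)"
    by (intro sum.cong) (auto simp: sum_psi)
  finally show ?thesis by simp
qed

end

section \<open>The quadratic character and Salie sums\<close>

text \<open>The value 0 at 0 lets sums run over the whole field or over the nonzero elements at
  will, and makes \<open>sum_quad_char_level_set\<close> hold at u = 2 and u = -2 as well.\<close>

definition quad_char :: "'a::finite_field \<Rightarrow> complex" where
  "quad_char x = (if x = 0 then 0 else if \<exists>y. x = y ^ 2 then 1 else -1)"

lemma quad_char_0 [simp]: "quad_char 0 = 0"
  by (simp add: quad_char_def)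

lemma quad_char_square: "x \<noteq> 0 \<Longrightarrow> quad_char (x ^ 2) = 1"
  by (auto simp: quad_char_def)

lemma quad_char_1 [simp]: "quad_char 1 = 1"
  using quad_char_square[of 1] by simp

lemma quad_char_cases: "x \<noteq> 0 \<Longrightarrow> quad_char x = 1 \<or> quad_char x = -1"
  by (auto simp: quad_char_def)

lemma quad_char_eq_1D: "quad_char x = 1 \<Longrightarrow> \<exists>y. x = y ^ 2"
  by (auto simp: quad_char_def split: if_splits)

section \<open>Discrete logarithms and cyclotomic classes\<close>

locale primitive_field =
  fixes \<gamma> :: "'a::finite_field"
  assumes primitive: "primitive_element \<gamma>"
begin

lemma gamma_nonzero [simp]: "\<gamma> \<noteq> 0"
  using primitive by (simp add: primitive_element_def)

lemma nonzero_powerE: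
  assumes "x \<noteq> 0"
  obtains n where "x = \<gamma> ^ n"
  using assms primitive by (auto simp: primitive_element_def)

lemma card_gt_1: "CARD('a) > 1"
  using card_mono[of UNIV "{0, 1 :: 'a}"] by simp

lemma power_card_minus_1: "x \<noteq> 0 \<Longrightarrow> x ^ (CARD('a) - 1) = (1 :: 'a)"
  using finite_field_power_card_eq_same[of x] card_gt_1
  by (cases "CARD('a)") auto

lemma gamma_power_mod: "\<gamma> ^ (n mod (CARD('a) - 1)) = \<gamma> ^ n"
proof -
  let ?Q = "CARD('a) - 1"
  have "\<gamma> ^ n = \<gamma> ^ (?Q * (n div ?Q) + n mod ?Q)" by simp
  also have "\<dots> = \<gamma> ^ (n mod ?Q)"
    by (simp only: power_add power_mult power_card_minus_1[OF gamma_nonzero] power_one mult_1_left)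
  finally show ?thesis by simp
qed

lemma gamma_power_image: "(\<lambda>n. \<gamma> ^ n) ` {..<CARD('a) - 1} = UNIV - {0}"
proof (intro subset_antisym subsetI)
  fix x :: 'a assume "x \<in> UNIV - {0}"
  then obtain n where "x = \<gamma> ^ n" by (auto elim: nonzero_powerE)
  hence "x = \<gamma> ^ (n mod (CARD('a) - 1))" by (simp only: gamma_power_mod)
  moreover have "n mod (CARD('a) - 1) < CARD('a) - 1" using card_gt_1 by simp
  ultimately show "x \<in> (\<lambda>n. \<gamma> ^ n) ` {..<CARD('a) - 1}" by blast
qed auto

lemma gamma_power_inj: "inj_on (\<lambda>n. \<gamma> ^ n) {..<CARD('a) - 1}"
  by (rule eq_card_imp_inj_on) (simp_all only: gamma_power_image finite_lessThan card_lessThan, simp)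

lemma gamma_power_eq_iff: "\<gamma> ^ a = \<gamma> ^ b \<longleftrightarrow> [a = b] (mod (CARD('a) - 1))"
proof
  assume "\<gamma> ^ a = \<gamma> ^ b"
  hence "\<gamma> ^ (a mod (CARD('a) - 1)) = \<gamma> ^ (b mod (CARD('a) - 1))" by (simp only: gamma_power_mod)
  thus "[a = b] (mod (CARD('a) - 1))"
    unfolding cong_def using card_gt_1 by (intro inj_onD[OF gamma_power_inj]) auto
next
  assume "[a = b] (mod (CARD('a) - 1))"
  thus "\<gamma> ^ a = \<gamma> ^ b" unfolding cong_def by (metis gamma_power_mod)
qed

lemma cyclotomic_class_iff:
  assumes N: "N dvd CARD('a) - 1"
  shows "\<gamma> ^ n \<in> cyclotomic_class \<gamma> N j \<longleftrightarrow> [n = j] (mod N)"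
proof
  assume "\<gamma> ^ n \<in> cyclotomic_class \<gamma> N j"
  then obtain i where "\<gamma> ^ n = \<gamma> ^ (j + N * i)"
    by (auto simp: cyclotomic_class_def power_add power_mult)
  hence "[n = j + N * i] (mod (CARD('a) - 1))" by (simp add: gamma_power_eq_iff)
  hence "[n = j + N * i] (mod N)" using N by (rule cong_dvd_modulus_nat)
  thus "[n = j] (mod N)" by (simp add: cong_def)
next
  assume n: "[n = j] (mod N)"
  \<comment> \<open>Exponents inside a class are natural numbers, so n is raised above j by a
    multiple of q - 1, which changes neither the power of \<gamma> nor the residue modulo N.\<close>
  define n' where "n' = n + (CARD('a) - 1) * j"
  have "n' \<ge> j" 
  proof -
    have "1 * j \<le> (CARD('a) - 1) * j" using card_gt_1 by (intro mult_right_mono) auto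
    thus ?thesis unfolding n'_def by (simp only: mult_1_left trans_le_add2)
  qed
  have "[n' = j] (mod N)"
    using n N unfolding n'_def cong_def by (metis add.right_neutral dvd_triv_left dvd_trans mod_add_right_eq mod_eq_0_iff_dvd)
  hence "N dvd n' - j" using \<open>n' \<ge> j\<close> by (metis cong_altdef_nat)
  then obtain i where i: "n' - j = N * i" by blast
  hence "n' = j + N * i" using \<open>n' \<ge> j\<close> by simp
  moreover have "\<gamma> ^ n = \<gamma> ^ n'" by (simp add: gamma_power_eq_iff n'_def cong_def)
  ultimately have "\<gamma> ^ n = \<gamma> ^ j * (\<gamma> ^ N) ^ i" by (simp add: power_add power_mult)
  thus "\<gamma> ^ n \<in> cyclotomic_class \<gamma> N j" by (auto simp: cyclotomic_class_def)
qed

lemma cyclotomic_class_nonzero: "x \<in> cyclotomic_class \<gamma> N j \<Longrightarrow> x \<noteq> 0"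
  by (auto simp: cyclotomic_class_def)

end

locale odd_primitive_field = primitive_field \<gamma> for \<gamma> :: "'a::finite_field" +
  assumes odd_card: "odd CARD('a)"
begin

lemma two_nonzero [simp]: "(2 :: 'a) \<noteq> 0"
proof
  assume "(2 :: 'a) = 0"
  hence "CHAR('a) dvd 2" using of_nat_eq_0_iff_char_dvd[where ?'a = 'a, of 2] by simp
  hence "CHAR('a) = 2"
    using prime_gt_1_nat[OF CHAR_prime[where ?'a = 'a]] by (auto dest!: dvd_imp_le)
  thus False using CHAR_dvd_CARD[where ?'a = 'a] odd_card by simp
qed

lemma four_nonzero [simp]: "(4 :: 'a) \<noteq> 0"
  using mult_eq_0_iff[of "2::'a" 2] by simp

lemma neq_uminus: "x \<noteq> 0 \<Longrightarrow> x \<noteq> - (x :: 'a)"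
proof
  assume "x \<noteq> 0" "x = - x"
  hence "2 * x = 0" by (simp only: mult_2) (metis add.right_inverse)
  thus False using \<open>x \<noteq> 0\<close> by simp
qed

lemma quad_char_gamma_power: "quad_char (\<gamma> ^ n) = (if even n then 1 else -1)"
proof -
  have "(\<exists>y. \<gamma> ^ n = y ^ 2) \<longleftrightarrow> even n"
  proof
    assume "\<exists>y. \<gamma> ^ n = y ^ 2"
    then obtain y where y: "\<gamma> ^ n = y ^ 2" by blast
    hence "y \<noteq> 0" by (auto simp: power_eq_0_iff dest: sym)
    then obtain i where "y = \<gamma> ^ i" by (rule nonzero_powerE)
    hence "\<gamma> ^ n = \<gamma> ^ (2 * i)" using y by (simp add: mult.commute flip: power_mult)
    hence "[n = 2 * i] (mod (CARD('a) - 1))" by (simp add: gamma_power_eq_iff)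
    hence "[n = 2 * i] (mod 2)" by (rule cong_dvd_modulus_nat) (use odd_card in simp)
    thus "even n" by (simp add: cong_def even_iff_mod_2_eq_zero)
  next
    assume "even n"
    thus "\<exists>y. \<gamma> ^ n = y ^ 2" by (metis evenE mult.commute power_mult)
  qed
  thus ?thesis by (simp add: quad_char_def)
qed

lemma quad_char_mult: "quad_char (x * y) = quad_char x * quad_char (y :: 'a)"
proof (cases "x = 0 \<or> y = 0")
  case False
  then obtain i j where "x = \<gamma> ^ i" "y = \<gamma> ^ j" by (metis nonzero_powerE)
  thus ?thesis by (simp add: quad_char_gamma_power flip: power_add)
qed auto

lemma quad_char_inverse: "quad_char (inverse x) = quad_char (x :: 'a)"
proof (cases "x = 0")
  case False
  have "quad_char x = quad_char (inverse x * x ^ 2)" using False by (simp add: field_simps power2_eq_square)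
  thus ?thesis using False by (simp add: quad_char_mult quad_char_square)
qed simp

lemma quad_char_divide: "quad_char (x / y) = quad_char x * quad_char (y :: 'a)"
  by (simp add: divide_inverse quad_char_mult quad_char_inverse)

lemma quad_char_mult_self: "x \<noteq> 0 \<Longrightarrow> quad_char x * quad_char (x :: 'a) = 1"
  using quad_char_cases[of x] by auto

lemma minus_1_eq_gamma_power: "- 1 = \<gamma> ^ ((CARD('a) - 1) div 2)"
proof -
  define x where "x = \<gamma> ^ ((CARD('a) - 1) div 2)"
  have "x ^ 2 = \<gamma> ^ (CARD('a) - 1)" using odd_card by (simp add: x_def flip: power_mult)
  hence "x = 1 \<or> x = - 1" using power_card_minus_1[OF gamma_nonzero] by (simp add: power2_eq_1_iff)
  moreover have "x \<noteq> \<gamma> ^ 0"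
    unfolding x_def gamma_power_eq_iff cong_def using card_gt_1 odd_card by (auto elim!: oddE)
  ultimately show ?thesis by (simp add: x_def)
qed

lemma quad_char_minus_1: "quad_char (- 1 :: 'a) = (if CARD('a) mod 4 = 1 then 1 else -1)"
proof -
  have "even ((CARD('a) - 1) div 2) \<longleftrightarrow> CARD('a) mod 4 = 1" using odd_card by presburger
  thus ?thesis by (simp add: minus_1_eq_gamma_power quad_char_gamma_power)
qed

lemma sum_quad_char: "(\<Sum>x\<in>UNIV - {0}. quad_char (x :: 'a)) = 0"
proof -
  have "(\<Sum>x\<in>UNIV - {0 :: 'a}. quad_char x) = (\<Sum>x\<in>UNIV - {0 :: 'a}. quad_char (\<gamma> * x))"
    by (rule sum.reindex_bij_witness[of _ "\<lambda>x. \<gamma> * x" "\<lambda>x :: 'a. x / \<gamma>"]) auto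
  also have "\<dots> = - (\<Sum>x\<in>UNIV - {0 :: 'a}. quad_char x)"
    using quad_char_gamma_power[of 1] by (simp add: quad_char_mult sum_negf)
  finally show ?thesis by simp
qed

text \<open>The solutions are t and 1/t, which have the same \<eta>, and u + 2 = (t+1)^2/t, u - 2 =
  (t-1)^2/t. If there is no solution, u^2 - 4 is a nonsquare and the right side cancels. The lemma
  turns a sum over t into two translated Gauss sums.\<close>

lemma sum_quad_char_level_set:
  "(\<Sum>t | t \<noteq> 0 \<and> t + inverse t = u. quad_char t) = quad_char (u + 2) + quad_char (u - 2 :: 'a)"
proof (cases "\<exists>t. t \<noteq> 0 \<and> t + inverse t = u")
  case True
  then obtain t where t: "t \<noteq> 0" "t + inverse t = u" by blast
  have set: "{s :: 'a. s \<noteq> 0 \<and> s + inverse s = u} = {t, inverse t}"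
  proof (intro subset_antisym subsetI)
    fix s assume "s \<in> {s. s \<noteq> 0 \<and> s + inverse s = u}"
    hence s: "s \<noteq> 0" "s + inverse s = t + inverse t" using t by auto
    have "(s - t) * (s * t - 1) = s * t * ((s + inverse s) - (t + inverse t))"
      using s(1) t(1) by (simp add: field_simps)
    hence "s = t \<or> s * t = 1" by (simp add: s(2))
    thus "s \<in> {t, inverse t}" using t by (auto simp: field_simps)
  qed (use t in \<open>auto simp: add.commute\<close>)
  have p: "u + 2 = (t + 1) ^ 2 / t" "u - 2 = (t - 1) ^ 2 / t"
    using t(1) by (simp_all add: field_simps power2_eq_square flip: t(2))
  show ?thesis
  proof (cases "t = 1 \<or> t = -1")
    case True
    \<comment> \<open>The double root: the level set has one element, and one of u + 2, u - 2 is 0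
      while the other is 4 or -4.\<close>
    have "(4 :: 'a) = 2 ^ 2" by simp
    hence "quad_char (4 :: 'a) = 1" by (metis quad_char_square two_nonzero)
    moreover have "quad_char (-4 :: 'a) = quad_char (-1 :: 'a) * quad_char (4 :: 'a)"
      using quad_char_mult[of "-1" 4] by simp
    ultimately show ?thesis using True t(2) unfolding set by auto
  next
    case False
    hence "t \<noteq> inverse t" using t by (metis left_inverse power2_eq_1_iff power2_eq_square)
    moreover have "t + 1 \<noteq> 0" "t - 1 \<noteq> 0" using False by (auto simp: eq_neg_iff_add_eq_0)
    ultimately show ?thesis
      unfolding set p using t by (simp add: quad_char_divide quad_char_square quad_char_inverse)
  qed
next
  case False
  have "quad_char ((u + 2) * (u - 2)) \<noteq> 1"
  proof
    assume "quad_char ((u + 2) * (u - 2)) = 1"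
    then obtain r where r: "(u + 2) * (u - 2) = r ^ 2" using quad_char_eq_1D by blast
    \<comment> \<open>The quadratic formula for t^2 - u t + 1 = 0; the other root (u - r)/2 is the
      inverse.\<close>
    define t where "t = (u + r) / 2"
    have "t * ((u - r) / 2) = (u ^ 2 - r ^ 2) / 4" by (simp add: t_def power2_eq_square algebra_simps)
    also have "u ^ 2 - r ^ 2 = 4" unfolding r[symmetric] by (simp add: power2_eq_square algebra_simps)
    finally have t: "t * ((u - r) / 2) = 1" by simp
    have "inverse t = (u - r) / 2" using t by (rule inverse_unique)
    moreover have "t \<noteq> 0" using t by (metis mult_zero_left zero_neq_one)
    moreover have "t + (u - r) / 2 = u" by (simp add: t_def flip: add_divide_distrib)
    ultimately show False using False by metis
  qed
  moreover have "u + 2 \<noteq> 0" "u - 2 \<noteq> 0"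
  proof -
    have "- 1 + inverse (- 1) \<noteq> u" "1 + inverse 1 \<noteq> u"
      using False by (metis neg_equal_0_iff_equal zero_neq_one)+
    thus "u + 2 \<noteq> 0" "u - 2 \<noteq> 0" by (auto simp: eq_neg_iff_add_eq_0[symmetric])
  qed
  ultimately have "quad_char (u + 2) + quad_char (u - 2) = 0"
    using quad_char_cases[of "u + 2"] quad_char_cases[of "u - 2"] by (auto simp: quad_char_mult)
  moreover have "{t. t \<noteq> 0 \<and> t + inverse t = u} = {}" using False by blast
  ultimately show ?thesis by (simp only: sum.empty)
qed

end

section \<open>The quadratic Gauss sum and the evaluation of Salie sums\<close>

locale quadratic_gauss = odd_primitive_field \<gamma> + additive_character \<psi>
  for \<gamma> :: "'a::finite_field" and \<psi> :: "'a \<Rightarrow> complex"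
begin

definition quad_gauss :: complex where
  "quad_gauss = (\<Sum>x\<in>UNIV. quad_char x * \<psi> x)"

lemma sum_quad_char_psi: "a \<noteq> 0 \<Longrightarrow> (\<Sum>x\<in>UNIV. quad_char x * \<psi> (a * x)) = quad_char a * quad_gauss"
proof -
  assume a: "a \<noteq> 0"
  have "(\<Sum>x\<in>UNIV. quad_char x * \<psi> (a * x)) = (\<Sum>x\<in>UNIV. quad_char (x / a) * \<psi> x)"
    by (rule sum.reindex_bij_witness[of _ "\<lambda>x. x / a" "\<lambda>x. a * x"]) (use a in auto)
  thus ?thesis by (simp add: quad_char_divide quad_gauss_def sum_distrib_left mult_ac)
qed

text \<open>Expanding \<eta>(y) G as the sum of \<eta>(x) \<psi>(xy) over x collects the square into
  characters \<psi>((1+x)y); orthogonality in y leaves x = -1, and the remaining terms add up to the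
  sum of \<eta>, which is 0.\<close>

lemma quad_gauss_squared: "quad_gauss ^ 2 = quad_char (- 1 :: 'a) * of_nat CARD('a)"
proof -
  have "quad_gauss ^ 2 = (\<Sum>y\<in>UNIV. (quad_char y * quad_gauss) * \<psi> y)"
    by (simp add: quad_gauss_def power2_eq_square sum_distrib_left mult_ac)
  also have "\<dots> = (\<Sum>y\<in>UNIV - {0}. (quad_char y * quad_gauss) * \<psi> y)"
    by (intro sum.mono_neutral_right) auto
  also have "\<dots> = (\<Sum>y\<in>UNIV - {0}. \<Sum>x\<in>UNIV. quad_char x * \<psi> ((1 + x) * y))"
    by (intro sum.cong) (simp_all add: psi_add sum_distrib_left sum_distrib_right algebra_simps flip: sum_quad_char_psi)
  also have "\<dots> = (\<Sum>x\<in>UNIV. quad_char x * (\<Sum>y\<in>UNIV - {0}. \<psi> ((1 + x) * y)))"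
    by (subst sum.swap) (simp add: sum_distrib_left)
  also have "\<dots> = (\<Sum>x\<in>UNIV. quad_char x * (if x = - (1 :: 'a) then of_nat CARD('a) else 0) - quad_char x)"
  proof (rule sum.cong[OF refl])
    fix x :: 'a
    have "(\<Sum>y\<in>UNIV. \<psi> ((1 + x) * y)) = 1 + (\<Sum>y\<in>UNIV - {0}. \<psi> ((1 + x) * y))"
      using sum.remove[of UNIV 0 "\<lambda>y. \<psi> ((1 + x) * y)"] by (simp add: psi_0)
    moreover have "1 + x = 0 \<longleftrightarrow> x = - 1" by (simp add: eq_neg_iff_add_eq_0 add.commute)
    ultimately have "(\<Sum>y\<in>UNIV - {0}. \<psi> ((1 + x) * y)) = (if x = - 1 then of_nat CARD('a) else 0) - 1"
      unfolding sum_psi[of "1 + x"] by (simp only: add_diff_cancel_left')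
    thus "quad_char x * (\<Sum>y\<in>UNIV - {0}. \<psi> ((1 + x) * y)) =
      quad_char x * (if x = - 1 then of_nat CARD('a) else 0) - quad_char x"
      by (simp only: right_diff_distrib mult_1_right)
  qed
  also have "\<dots> = quad_char (- 1 :: 'a) * of_nat CARD('a) - (\<Sum>x\<in>UNIV. quad_char (x :: 'a))"
    by (simp only: sum_subtractf) (simp add: if_distrib cong: if_cong)
  also have "(\<Sum>x\<in>UNIV. quad_char (x :: 'a)) = 0"
    using sum_quad_char sum.remove[of UNIV "0::'a" quad_char] by simp
  finally show ?thesis by simp
qed

text \<open>The substitution x -> c/(ax) exchanges ax and c/x and multiplies \<eta>(x) by
  \<eta>(ac), so the sum vanishes when ac is a nonsquare. When ac = d^2, the substitution x = (d/a)
  t makes the argument d (t + 1/t), and the sum is regrouped by the value of t + 1/t.\<close>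

lemma salie_sum:
  assumes a: "a \<noteq> 0" and c: "c \<noteq> 0"
  shows "(\<Sum>x\<in>UNIV - {0}. quad_char x * \<psi> (a * x + c / x)) =
    quad_char a * quad_gauss * (\<Sum>y | y ^ 2 = 4 * a * c. \<psi> y)"
proof (cases "\<exists>d. a * c = d ^ 2")
  case False
  define S where "S = (\<Sum>x\<in>UNIV - {0}. quad_char x * \<psi> (a * x + c / x))"
  have "S = (\<Sum>x\<in>UNIV - {0}. quad_char (c / (a * x)) * \<psi> (a * x + c / x))"
    unfolding S_def
    by (rule sum.reindex_bij_witness[of _ "\<lambda>x. c / (a * x)" "\<lambda>x. c / (a * x)"])
       (use a c in \<open>auto simp: add.commute\<close>)
  also have "\<dots> = quad_char (a * c) * S"
    by (simp add: S_def quad_char_divide quad_char_mult sum_distrib_left mult_ac)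
  also have "quad_char (a * c) = -1"
    using False a c by (simp add: quad_char_def)
  finally have "S = 0" by simp
  moreover have "{y. y ^ 2 = 4 * a * c} = {}"
  proof (intro equals0I)
    fix y assume "y \<in> {y. y ^ 2 = 4 * a * c}"
    hence "a * c = (y / 2) ^ 2" by (simp add: power_divide)
    thus False using False by blast
  qed
  ultimately show ?thesis by (simp add: S_def)
next
  case True
  then obtain d where d: "a * c = d ^ 2" by blast
  hence "d \<noteq> 0" using a c by auto
  have "{y. y ^ 2 = 4 * a * c} = {2 * d, - (2 * d)}"
  proof -
    have "4 * a * c = (2 * d) ^ 2" by (simp add: d power_mult_distrib mult.assoc)
    hence "y ^ 2 = 4 * a * c \<longleftrightarrow> y = 2 * d \<or> y = - (2 * d)" for y by (simp only: power2_eq_iff)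
    thus ?thesis by blast
  qed
  moreover have "2 * d \<noteq> - (2 * d)" using neq_uminus[of "2 * d"] \<open>d \<noteq> 0\<close> by simp
  ultimately have rhs: "(\<Sum>y | y ^ 2 = 4 * a * c. \<psi> y) = \<psi> (2 * d) + \<psi> (- (2 * d))" by simp
  \<comment> \<open>Two factors \<eta>(d) appear, one from the substitution and one from scaling the
    Gauss sum by d. They cancel, so the choice of the square root d leaves no trace.\<close>
  have alg: "e * b * (e * g * y + e * g * x) = (e * e) * (b * g * (x + y))" for b e g x y :: complex
    by (simp add: algebra_simps)
  have "(\<Sum>x\<in>UNIV - {0}. quad_char x * \<psi> (a * x + c / x)) =
     (\<Sum>t\<in>UNIV - {0}. quad_char (d / a * t) * \<psi> (d * (t + inverse t)))"
  proof (rule sum.reindex_bij_witness[of _ "\<lambda>t. d / a * t" "\<lambda>x. a / d * x"])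
    fix x assume "x \<in> UNIV - {0 :: 'a}"
    hence "x \<noteq> 0" by simp
    have "c = d ^ 2 / a" using d a by (simp add: field_simps)
    hence "d * (a / d * x + inverse (a / d * x)) = a * x + c / x"
      using a \<open>d \<noteq> 0\<close> \<open>x \<noteq> 0\<close> by (simp add: field_simps power2_eq_square)
    thus "quad_char (d / a * (a / d * x)) * \<psi> (d * (a / d * x + inverse (a / d * x))) =
          quad_char x * \<psi> (a * x + c / x)"
      using a \<open>d \<noteq> 0\<close> by (simp only:) (simp add: mult.assoc[symmetric])
  qed (use a \<open>d \<noteq> 0\<close> in auto)
  also have "\<dots> = quad_char (d / a) * (\<Sum>t\<in>UNIV - {0}. quad_char t * \<psi> (d * (t + inverse t)))"
    unfolding quad_char_mult sum_distrib_left by (simp add: mult_ac)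
  also have "(\<Sum>t\<in>UNIV - {0}. quad_char t * \<psi> (d * (t + inverse t))) =
     (\<Sum>u\<in>UNIV. \<Sum>t | t \<in> UNIV - {0} \<and> t + inverse t = u. quad_char t * \<psi> (d * (t + inverse t)))"
    by (rule sum.group[symmetric]) auto
  also have "\<dots> = (\<Sum>u\<in>UNIV. (\<Sum>t | t \<noteq> 0 \<and> t + inverse t = u. quad_char t) * \<psi> (d * u))"
    by (auto intro!: sum.cong simp: sum_distrib_right)
  also have "\<dots> = (\<Sum>u\<in>UNIV. quad_char (u + 2) * \<psi> (d * u)) + (\<Sum>u\<in>UNIV. quad_char (u - 2) * \<psi> (d * u))"
    unfolding sum_quad_char_level_set by (simp add: algebra_simps sum.distrib)
  also have "(\<Sum>u\<in>UNIV. quad_char (u + 2) * \<psi> (d * u)) = (\<Sum>u\<in>UNIV. quad_char u * \<psi> (d * u)) * \<psi> (- (2 * d))"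
    unfolding sum_distrib_right
    by (rule sum.reindex_bij_witness[of _ "\<lambda>u. u - 2" "\<lambda>u. u + 2"])
       (auto simp: algebra_simps simp flip: psi_add)
  also have "(\<Sum>u\<in>UNIV. quad_char (u - 2) * \<psi> (d * u)) = (\<Sum>u\<in>UNIV. quad_char u * \<psi> (d * u)) * \<psi> (2 * d)"
    unfolding sum_distrib_right
    by (rule sum.reindex_bij_witness[of _ "\<lambda>u. u + 2" "\<lambda>u. u - 2"])
       (auto simp: algebra_simps simp flip: psi_add)
  finally show ?thesis
    unfolding rhs sum_quad_char_psi[OF \<open>d \<noteq> 0\<close>] quad_char_divide alg
    by (simp add: quad_char_mult_self[OF \<open>d \<noteq> 0\<close>])
qed

lemma salie_sum_over_set:
  assumes a: "a \<noteq> 0" and C: "0 \<notin> C"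
  shows "(\<Sum>x\<in>UNIV - {0}. quad_char x * \<psi> (a * x) * (\<Sum>c\<in>C. \<psi> (c / x))) =
    quad_char a * quad_gauss * (\<Sum>y | y ^ 2 / (4 * a) \<in> C. \<psi> y)"
proof -
  have "(\<Sum>x\<in>UNIV - {0}. quad_char x * \<psi> (a * x) * (\<Sum>c\<in>C. \<psi> (c / x))) =
     (\<Sum>c\<in>C. \<Sum>x\<in>UNIV - {0}. quad_char x * \<psi> (a * x + c / x))"
    by (subst sum.swap) (simp add: sum_distrib_left psi_add mult_ac)
  also have "\<dots> = (\<Sum>c\<in>C. quad_char a * quad_gauss * (\<Sum>y | y ^ 2 = 4 * a * c. \<psi> y))"
    using a C by (intro sum.cong refl salie_sum) auto
  also have "\<dots> = quad_char a * quad_gauss * (\<Sum>c\<in>C. \<Sum>y | y \<in> {y. y ^ 2 / (4 * a) \<in> C} \<and> y ^ 2 / (4 * a) = c. \<psi> y)"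
    unfolding sum_distrib_left[symmetric] using a
    by (intro arg_cong2[of _ _ _ _ "(*)"] refl sum.cong) (auto simp: field_simps)
  also have "\<dots> = quad_char a * quad_gauss * (\<Sum>y | y ^ 2 / (4 * a) \<in> C. \<psi> y)"
    by (subst sum.group) auto
  finally show ?thesis .
qed

end

section \<open>Multiplicative characters and Gauss sums\<close>

lemma poly_of_int_sum_monom:
  "poly (of_int_poly (\<Sum>x\<in>A. Polynomial.monom (w x) (e x))) y =
    (\<Sum>x\<in>A. of_int (w x) * y ^ e x :: 'a::comm_ring_1)"
  by (simp add: of_int_poly_hom.hom_sum poly_sum poly_monom map_poly_monom)

locale mult_character = primitive_field \<gamma> for \<gamma> :: "'a::finite_field" +
  fixes \<chi> :: "'a \<Rightarrow> complex" and k :: nat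
  assumes mult_char: "mult_char \<chi>" and order: "mult_char_order \<chi> = k"
begin

lemma chi_nonzero: "x \<noteq> 0 \<Longrightarrow> \<chi> x \<noteq> 0"
  using mult_char by (simp add: mult_char_def)

lemma chi_mult: "x \<noteq> 0 \<Longrightarrow> y \<noteq> 0 \<Longrightarrow> \<chi> (x * y) = \<chi> x * \<chi> y"
  using mult_char by (simp add: mult_char_def)

lemma chi_1 [simp]: "\<chi> 1 = 1"
  using chi_mult[of 1 1] chi_nonzero[of 1] by simp

lemma chi_power: "x \<noteq> 0 \<Longrightarrow> \<chi> (x ^ n) = \<chi> x ^ n"
  by (induction n) (simp_all add: chi_mult)

lemma chi_inverse:
  assumes "x \<noteq> 0"
  shows "\<chi> (inverse x) = inverse (\<chi> x)"
proof (rule inverse_unique[symmetric])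
  show "\<chi> x * \<chi> (inverse x) = 1" using assms chi_mult[of x "inverse x"] by simp
qed

lemma chi_divide: "x \<noteq> 0 \<Longrightarrow> y \<noteq> 0 \<Longrightarrow> \<chi> (x / y) = \<chi> x / \<chi> y"
  by (simp add: divide_inverse chi_mult chi_inverse)

lemma order_pos: "k > 0" and chi_power_order: "x \<noteq> 0 \<Longrightarrow> \<chi> x ^ k = 1"
proof -
  have "\<chi> x ^ (CARD('a) - 1) = 1" if "x \<noteq> 0" for x
    using chi_power[OF that, of "CARD('a) - 1"] unfolding power_card_minus_1[OF that] chi_1 by simp
  hence "CARD('a) - 1 > 0 \<and> (\<forall>x. x \<noteq> 0 \<longrightarrow> \<chi> x ^ (CARD('a) - 1) = 1)"
    using card_gt_1 by (simp only: zero_less_diff simp_thms) blast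
  hence "k > 0 \<and> (\<forall>x. x \<noteq> 0 \<longrightarrow> \<chi> x ^ k = 1)"
    unfolding order[symmetric] mult_char_order_def by (rule LeastI)
  thus "k > 0" "x \<noteq> 0 \<Longrightarrow> \<chi> x ^ k = 1" by auto
qed

lemma chi_gamma_power_eq_1_iff: "\<chi> \<gamma> ^ n = 1 \<longleftrightarrow> k dvd n"
proof
  assume n: "\<chi> \<gamma> ^ n = 1"
  define r where "r = n mod k"
  have "\<chi> \<gamma> ^ n = \<chi> \<gamma> ^ (k * (n div k) + r)" by (simp add: r_def)
  also have "\<dots> = \<chi> \<gamma> ^ r" by (simp add: power_add power_mult chi_power_order)
  finally have r: "\<chi> \<gamma> ^ r = 1" using n by simp
  have "\<chi> x ^ r = 1" if x: "x \<noteq> 0" for x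
  proof -
    obtain i where "x = \<gamma> ^ i" using x by (rule nonzero_powerE)
    hence "\<chi> x ^ r = (\<chi> \<gamma> ^ r) ^ i" by (simp add: chi_power mult.commute flip: power_mult)
    thus ?thesis using r by simp
  qed
  moreover have "\<not> (r > 0 \<and> (\<forall>x. x \<noteq> 0 \<longrightarrow> \<chi> x ^ r = 1))"
    using order_pos unfolding r_def
    by (intro not_less_Least[of _ "\<lambda>n. n > 0 \<and> (\<forall>x. x \<noteq> 0 \<longrightarrow> \<chi> x ^ n = 1)"])
       (simp add: order[symmetric] mult_char_order_def)
  ultimately show "k dvd n" by (simp add: r_def dvd_eq_mod_eq_0)
next
  assume "k dvd n"
  thus "\<chi> \<gamma> ^ n = 1" by (auto simp: power_mult chi_power_order)
qed

lemma chi_gamma_power_eq_iff: "\<chi> (\<gamma> ^ a) = \<chi> (\<gamma> ^ b) \<longleftrightarrow> [a = b] (mod k)"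
proof -
  have *: "\<chi> \<gamma> ^ a = \<chi> \<gamma> ^ b \<longleftrightarrow> [a = b] (mod k)" if "a \<le> b" for a b
  proof -
    have "\<chi> \<gamma> ^ b = \<chi> \<gamma> ^ a * \<chi> \<gamma> ^ (b - a)" using that by (simp flip: power_add)
    hence "\<chi> \<gamma> ^ a = \<chi> \<gamma> ^ b \<longleftrightarrow> \<chi> \<gamma> ^ (b - a) = 1" by (simp add: chi_nonzero)
    thus ?thesis unfolding chi_gamma_power_eq_1_iff
      using cong_altdef_nat[OF that, of k] by (simp add: cong_sym_eq)
  qed
  show ?thesis using *[of a b] *[of b a] by (cases "a \<le> b") (auto simp: chi_power cong_sym_eq)
qed

lemma order_dvd_card: "k dvd CARD('a) - 1"
  unfolding chi_gamma_power_eq_1_iff[symmetric]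
  using chi_power[of \<gamma> "CARD('a) - 1"] by (simp only: power_card_minus_1 chi_1 gamma_nonzero simp_thms)

text \<open>The fibres of \<chi> are the cosets of C_0. Later arguments therefore name a coset by
  its value of \<chi>, and a set of inequivalent representatives is one on which \<chi> is
  injective.\<close>

lemma chi_eq_iff_class:
  assumes "x \<noteq> 0" "y \<noteq> 0"
  shows "\<chi> x = \<chi> y \<longleftrightarrow> y / x \<in> cyclotomic_class \<gamma> k 0"
proof -
  obtain n where n: "y / x = \<gamma> ^ n" using assms by (metis divide_eq_0_iff nonzero_powerE)
  have "\<chi> x = \<chi> y \<longleftrightarrow> \<chi> (y / x) = 1" using assms by (auto simp: chi_divide chi_nonzero)
  also have "\<dots> \<longleftrightarrow> k dvd n" by (simp add: n chi_power chi_gamma_power_eq_1_iff)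
  finally show ?thesis by (simp add: n cyclotomic_class_iff[OF order_dvd_card] cong_0_iff)
qed

lemma sum_chi_powers:
  assumes "x \<noteq> 0" "y \<noteq> 0"
  shows "(\<Sum>j<k. (\<chi> x / \<chi> y) ^ j) = (if \<chi> x = \<chi> y then of_nat k else 0)"
proof (cases "\<chi> x = \<chi> y")
  case False
  have "(\<chi> x / \<chi> y) ^ k = 1" using assms by (simp add: power_divide chi_power_order)
  moreover have "\<chi> x / \<chi> y \<noteq> 1" using False chi_nonzero[OF assms(2)] by simp
  ultimately show ?thesis using False by (simp add: geometric_sum)
qed (simp add: chi_nonzero[OF assms(2)])

text \<open>Multiplication by \<chi>(\<gamma>) permutes the values of \<chi>, while
  \<chi>(\<gamma>)^j is not 1. This makes the sums over the two parts of L opposite for each such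
  power.\<close>

lemma sum_chi_transversal:
  assumes L: "inj_on \<chi> L" "\<chi> ` L = \<chi> ` (UNIV - {0})" and j: "\<not> k dvd j"
  shows "(\<Sum>x\<in>L. \<chi> x ^ j) = 0"
proof -
  let ?U = "\<chi> ` (UNIV - {0})"
  have 1: "(\<Sum>x\<in>L. \<chi> x ^ j) = (\<Sum>u\<in>?U. u ^ j)"
    unfolding L(2)[symmetric] by (simp add: sum.reindex[OF L(1)])
  have "(\<Sum>u\<in>?U. u ^ j) = (\<Sum>u\<in>?U. (\<chi> \<gamma> * u) ^ j)"
  proof (rule sum.reindex_bij_witness[of _ "\<lambda>u. \<chi> \<gamma> * u" "\<lambda>u. u / \<chi> \<gamma>"])
    fix u assume "u \<in> ?U"
    then obtain x where x: "x \<noteq> 0" "u = \<chi> x" by auto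
    hence "\<chi> \<gamma> * u = \<chi> (\<gamma> * x)" "u / \<chi> \<gamma> = \<chi> (x / \<gamma>)" by (simp_all add: chi_mult chi_divide)
    moreover have "\<gamma> * x \<in> UNIV - {0}" "x / \<gamma> \<in> UNIV - {0}" using x by auto
    ultimately show "\<chi> \<gamma> * u \<in> ?U" "u / \<chi> \<gamma> \<in> ?U" by (simp_all only: imageI)
  qed (simp_all add: chi_nonzero)
  also have "\<dots> = \<chi> \<gamma> ^ j * (\<Sum>u\<in>?U. u ^ j)"
    by (simp add: power_mult_distrib sum_distrib_left)
  finally have "(\<Sum>u\<in>?U. u ^ j) = 0"
    unfolding mult_cancel_right1 using j chi_gamma_power_eq_1_iff[of j] by blast
  with 1 show ?thesis by (rule trans)
qed

end

locale character_pair = mult_character \<gamma> \<chi> k + additive_character \<psi>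
  for \<gamma> :: "'a::finite_field" and \<chi> :: "'a \<Rightarrow> complex" and k :: nat and \<psi> :: "'a \<Rightarrow> complex"
begin

text \<open>A nonzero element of the prime field is killed by the exponent p - 1, so its logarithm
  is a multiple of (q-1)/(p-1) and hence of k.\<close>

lemma chi_prime_field_trivial:
  assumes card: "CARD('a) = CHAR('a) ^ n" and k: "k dvd (CARD('a) - 1) div (CHAR('a) - 1)"
    and t: "(of_nat t :: 'a) \<noteq> 0"
  shows "\<chi> (of_nat t) = 1"
proof -
  define p where "p = CHAR('a)"
  have p: "p > 1" using prime_gt_1_nat[OF CHAR_prime[where ?'a = 'a]] by (simp add: p_def)
  have "(of_nat t :: 'a) ^ p = of_nat t" by (simp add: p_def of_nat_power_CHAR)
  moreover have "(of_nat t :: 'a) ^ p = of_nat t ^ (p - 1) * of_nat t"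
    using p by (metis One_nat_def Suc_diff_1 gr0I not_less0 power_Suc2)
  ultimately have tp: "(of_nat t :: 'a) ^ (p - 1) = 1" using t by simp
  obtain a where a: "of_nat t = \<gamma> ^ a" using t by (rule nonzero_powerE)
  have "\<gamma> ^ (a * (p - 1)) = \<gamma> ^ 0" using tp by (simp add: a power_mult)
  hence "CARD('a) - 1 dvd a * (p - 1)" by (simp only: gamma_power_eq_iff cong_0_iff)
  moreover have "(p - 1) dvd CARD('a) - 1"
  proof -
    have "[p = 1] (mod (p - 1))" using p by (simp add: cong_altdef_nat)
    hence "[p ^ n = 1 ^ n] (mod (p - 1))" by (rule cong_pow)
    thus ?thesis using p by (simp add: cong_altdef_nat card flip: p_def)
  qed
  then obtain c where c: "CARD('a) - 1 = (p - 1) * c" by blast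
  ultimately have "c dvd a" using p by (simp add: mult.commute)
  moreover have "k dvd c"
  proof -
    have "p - 1 \<noteq> 0" using p by simp
    hence "(p - 1) * c div (p - 1) = c" by (rule nonzero_mult_div_cancel_left)
    thus ?thesis using k unfolding p_def[symmetric] c by (simp only:)
  qed
  ultimately show ?thesis by (simp add: a chi_power chi_gamma_power_eq_1_iff) (rule dvd_trans)
qed

text \<open>Since \<open>\<chi>\<close> is trivial on the prime field, \<open>p - 1\<close> times the Gauss sum of \<open>\<chi>\<close> is an
  integral combination of values of \<open>\<chi>\<close>, so no Galois theory over \<open>\<rat>(\<zeta>\<^sub>p)\<close> is needed.\<close>

lemma gauss_sum_eq_power_coprime:
  assumes card: "CARD('a) = CHAR('a) ^ n" and k: "k dvd (CARD('a) - 1) div (CHAR('a) - 1)"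
    and S: "0 \<notin> S" and G: "(\<Sum>x\<in>UNIV - {0}. \<chi> x * \<psi> x) = of_int c * (\<Sum>x\<in>S. \<chi> x)"
    and j: "coprime j k" "j > 0"
  shows "(\<Sum>x\<in>UNIV - {0}. \<chi> x ^ j * \<psi> x) = of_int c * (\<Sum>x\<in>S. \<chi> x ^ j)"
proof -
  define p where "p = CHAR('a)"
  have p: "p > 1" using prime_gt_1_nat[OF CHAR_prime[where ?'a = 'a]] by (simp add: p_def)
  define lg where "lg x = (SOME n. x = \<gamma> ^ n)" for x
  have chi_lg: "\<chi> x ^ i = (\<chi> \<gamma> ^ i) ^ lg x" if x: "x \<noteq> 0" for x i
  proof -
    obtain n where "x = \<gamma> ^ n" using x by (rule nonzero_powerE)
    hence "x = \<gamma> ^ lg x" unfolding lg_def by (rule someI)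
    hence "\<chi> x = \<chi> (\<gamma> ^ lg x)" by (rule arg_cong)
    hence "\<chi> x = \<chi> \<gamma> ^ lg x" by (simp only: chi_power[OF gamma_nonzero])
    thus ?thesis by (simp add: mult.commute flip: power_mult)
  qed
  \<comment> \<open>The trace of \<psi>(x) from the p-th cyclotomic field: p - 1 for the trivial
    root of unity and -1 for every other one.\<close>
  define w where "w x = (if \<psi> x = 1 then int p - 1 else - 1)" for x
  have w: "(\<Sum>t\<in>{1..<p}. \<psi> x ^ t) = of_int (w x)" for x
  proof (cases "\<psi> x = 1")
    case False
    have "\<psi> x ^ p = \<psi> (of_nat p * x)" by (simp add: psi_of_nat_mult)
    hence "\<psi> x ^ p = 1" by (simp add: p_def psi_0)
    hence "(\<Sum>t<p. \<psi> x ^ t) = 0" using False by (simp add: geometric_sum)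
    moreover have "{..<p} = insert 0 {1..<p}" using p by auto
    ultimately show ?thesis using False by (simp add: w_def eq_neg_iff_add_eq_0 add.commute)
  qed (use p in \<open>simp add: w_def\<close>)
  \<comment> \<open>One integer polynomial for all exponents: at \<chi>(\<gamma>)^i it measures p -
    1 times the failure of the identity for \<chi>^i. It vanishes for i = 1, and conjugation moves
    this to i = j.\<close>
  define h where "h = (\<Sum>x\<in>UNIV - {0}. Polynomial.monom (w x) (lg x)) -
    (\<Sum>x\<in>S. Polynomial.monom ((int p - 1) * c) (lg x))"
  have h: "poly (of_int_poly h) (\<chi> \<gamma> ^ i) = (of_nat p - 1) *
      ((\<Sum>x\<in>UNIV - {0}. \<chi> x ^ i * \<psi> x) - of_int c * (\<Sum>x\<in>S. \<chi> x ^ i))" for i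
  proof -
    have "of_nat (p - 1) * (\<Sum>x\<in>UNIV - {0}. \<chi> x ^ i * \<psi> x) =
      (\<Sum>t\<in>{1..<p}. \<Sum>x\<in>UNIV - {0}. \<chi> x ^ i * \<psi> x)" by simp
    also have "\<dots> = (\<Sum>t\<in>{1..<p}. \<Sum>x\<in>UNIV - {0}. \<chi> x ^ i * \<psi> x ^ t)"
    proof (rule sum.cong[OF refl])
      fix t assume t: "t \<in> {1..<p}"
      hence t0: "(of_nat t :: 'a) \<noteq> 0"
        by (auto simp: of_nat_eq_0_iff_char_dvd p_def dest: nat_dvd_not_less)
      \<comment> \<open>Scaling x by t does not affect \<chi>, so the Gauss sum equals each of its p
        - 1 variants with \<psi>^t in place of \<psi>, and averaging over t produces the integers
        \<open>w x\<close>.\<close>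
      have "(\<Sum>x\<in>UNIV - {0}. \<chi> x ^ i * \<psi> x) =
        (\<Sum>x\<in>UNIV - {0}. \<chi> (of_nat t * x) ^ i * \<psi> (of_nat t * x))"
        by (rule sum.reindex_bij_witness[of _ "\<lambda>x. of_nat t * x" "\<lambda>x. x / of_nat t"]) (use t0 in auto)
      also have "\<dots> = (\<Sum>x\<in>UNIV - {0}. \<chi> x ^ i * \<psi> x ^ t)"
        using t0 by (intro sum.cong)
          (simp_all add: chi_mult psi_of_nat_mult chi_prime_field_trivial[OF card k])
      finally show "(\<Sum>x\<in>UNIV - {0}. \<chi> x ^ i * \<psi> x) = (\<Sum>x\<in>UNIV - {0}. \<chi> x ^ i * \<psi> x ^ t)" .
    qed
    also have "\<dots> = (\<Sum>x\<in>UNIV - {0}. \<chi> x ^ i * of_int (w x))"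
      by (subst sum.swap) (simp only: sum_distrib_left[symmetric] w)
    also have "\<dots> = (\<Sum>x\<in>UNIV - {0}. of_int (w x) * (\<chi> \<gamma> ^ i) ^ lg x)"
    proof (rule sum.cong[OF refl])
      fix x :: 'a assume "x \<in> UNIV - {0}"
      hence "x \<noteq> 0" by simp
      show "\<chi> x ^ i * of_int (w x) = of_int (w x) * (\<chi> \<gamma> ^ i) ^ lg x"
        unfolding chi_lg[OF \<open>x \<noteq> 0\<close>, of i] by (rule mult.commute)
    qed
    finally have 1: "(of_nat p - 1) * (\<Sum>x\<in>UNIV - {0}. \<chi> x ^ i * \<psi> x) =
      (\<Sum>x\<in>UNIV - {0}. of_int (w x) * (\<chi> \<gamma> ^ i) ^ lg x)"
      using p by (simp add: of_nat_diff)
    have 2: "(\<Sum>x\<in>S. \<chi> x ^ i) = (\<Sum>x\<in>S. (\<chi> \<gamma> ^ i) ^ lg x)"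
      using S by (intro sum.cong refl chi_lg) auto
    show ?thesis
      unfolding h_def right_diff_distrib 1 2 of_int_poly_hom.hom_minus poly_diff poly_of_int_sum_monom
      by (simp add: sum_distrib_left mult.assoc)
  qed
  have "poly (of_int_poly h) (\<chi> \<gamma>) = 0"
    using h[of 1] G by simp
  hence "poly (of_int_poly h) (\<chi> \<gamma> ^ j) = 0"
    using order_pos chi_power_order[OF gamma_nonzero] j
    by (intro int_poly_root_of_unity_power_coprime[of k])
  moreover have "complex_of_nat p - 1 \<noteq> 0"
    using p by simp
  ultimately show ?thesis unfolding h by simp
qed

text \<open>Orthogonality of the powers \<chi>^j with j < k isolates one coset. Were the formula in
  \<open>G\<close> valid at j = 0 too, only the indicator term would remain; the actual value -1
  there accounts for the constant.\<close>

lemma class_sum_two_valued: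
  assumes U: "0 \<notin> U" "inj_on \<chi> U"
    and G: "\<And>j. \<not> k dvd j \<Longrightarrow> (\<Sum>x\<in>UNIV - {0}. \<chi> x ^ j * \<psi> x) = B * (\<Sum>z\<in>U. \<chi> z ^ j)"
    and b: "b \<noteq> 0"
  shows "(\<Sum>x | x \<noteq> 0 \<and> \<chi> x = \<chi> b. \<psi> x) =
    - (1 + B * of_nat (card U)) / of_nat k + B * of_bool (\<exists>z\<in>U. \<chi> z = \<chi> b)"
proof -
  have U0: "z \<noteq> 0" if "z \<in> U" for z using that U by auto
  \<comment> \<open>The inverted sum with the formula in \<open>G\<close> extended to j = 0, where
    it gives B |U| instead of -1.\<close>
  define T where "T = (\<Sum>j<k. inverse (\<chi> b) ^ j * (B * (\<Sum>z\<in>U. \<chi> z ^ j)))"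
  have G0: "(\<Sum>x\<in>UNIV - {0}. \<chi> x ^ 0 * \<psi> x) = - 1"
    using sum_psi_nonzero[of 1] by simp
  have "of_nat k * (\<Sum>x | x \<noteq> 0 \<and> \<chi> x = \<chi> b. \<psi> x) =
     (\<Sum>x\<in>UNIV - {0}. if \<chi> x = \<chi> b then of_nat k * \<psi> x else 0)"
    by (simp add: sum_distrib_left sum.If_cases Int_def)
  also have "\<dots> = (\<Sum>x\<in>UNIV - {0}. (\<Sum>j<k. (\<chi> x / \<chi> b) ^ j) * \<psi> x)"
    using b by (intro sum.cong) (simp_all add: sum_chi_powers)
  also have "\<dots> = (\<Sum>j<k. inverse (\<chi> b) ^ j * (\<Sum>x\<in>UNIV - {0}. \<chi> x ^ j * \<psi> x))"
    unfolding sum_distrib_right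
    by (subst sum.swap) (simp add: sum_distrib_left divide_inverse power_mult_distrib mult_ac)
  also have "\<dots> = T - 1 - B * of_nat (card U)"
  proof -
    have k: "{..<k} = insert 0 {1..<k}" using order_pos by auto
    have "\<not> k dvd j" if "j \<in> {1..<k}" for j using that by (auto dest: nat_dvd_not_less)
    thus ?thesis unfolding T_def k using G0 by (simp add: G)
  qed
  also have "T = B * (\<Sum>z\<in>U. \<Sum>j<k. (\<chi> z / \<chi> b) ^ j)"
    unfolding T_def by (subst sum.swap) (simp add: sum_distrib_left divide_inverse power_mult_distrib mult_ac)
  also have "(\<Sum>z\<in>U. \<Sum>j<k. (\<chi> z / \<chi> b) ^ j) = (\<Sum>z\<in>U. if \<chi> z = \<chi> b then of_nat k else 0)"
    using b U0 by (intro sum.cong) (simp_all add: sum_chi_powers)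
  also have "\<dots> = of_nat k * of_bool (\<exists>z\<in>U. \<chi> z = \<chi> b)"
  proof (cases "\<exists>z\<in>U. \<chi> z = \<chi> b")
    case True
    then obtain z where z: "z \<in> U" "\<chi> z = \<chi> b" by blast
    have "(\<Sum>y\<in>U. if \<chi> y = \<chi> b then of_nat k else 0) = (\<Sum>y\<in>U. if y = z then of_nat k else 0 :: complex)"
      using z inj_on_eq_iff[OF U(2) _ z(1)] by (intro sum.cong) auto
    thus ?thesis using z by (auto simp: finite_subset[OF subset_UNIV])
  qed auto
  finally show ?thesis using order_pos by (simp add: field_simps)
qed

end

section \<open>Difference sets from two-valued class sums\<close>

context additive_character
begin

definition diff_count :: "'a set \<Rightarrow> 'a \<Rightarrow> nat" where
  "diff_count D g = card {(x, y). x \<in> D \<and> y \<in> D \<and> x - y = g}"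

lemma sum_diff_count_psi:
  "(\<Sum>g\<in>UNIV. of_nat (diff_count D g) * \<psi> (a * g)) = (\<Sum>x\<in>D. \<psi> (a * x)) * (\<Sum>y\<in>D. \<psi> (- a * y))"
proof -
  have "(\<Sum>g\<in>UNIV. of_nat (diff_count D g) * \<psi> (a * g)) =
     (\<Sum>g\<in>UNIV. \<Sum>p | p \<in> D \<times> D \<and> fst p - snd p = g. \<psi> (a * (fst p - snd p)))"
  proof (rule sum.cong[OF refl])
    fix g :: 'a
    have "{(x, y). x \<in> D \<and> y \<in> D \<and> x - y = g} = {p. p \<in> D \<times> D \<and> fst p - snd p = g}" by auto
    moreover have "(\<Sum>p | p \<in> D \<times> D \<and> fst p - snd p = g. \<psi> (a * (fst p - snd p))) =
       (\<Sum>p | p \<in> D \<times> D \<and> fst p - snd p = g. \<psi> (a * g))" by (intro sum.cong) auto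
    ultimately show "of_nat (diff_count D g) * \<psi> (a * g) =
      (\<Sum>p | p \<in> D \<times> D \<and> fst p - snd p = g. \<psi> (a * (fst p - snd p)))"
      by (simp add: diff_count_def)
  qed
  also have "\<dots> = (\<Sum>p\<in>D \<times> D. \<psi> (a * (fst p - snd p)))" by (rule sum.group) auto
  also have "\<dots> = (\<Sum>p\<in>D \<times> D. \<psi> (a * fst p) * \<psi> (- a * snd p))"
    by (intro sum.cong refl) (simp add: algebra_simps flip: psi_add)
  also have "\<dots> = (\<Sum>x\<in>D. \<psi> (a * x)) * (\<Sum>y\<in>D. \<psi> (- a * y))"
    by (simp add: sum_product sum.cartesian_product case_prod_beta)
  finally show ?thesis .
qed

text \<open>If \<psi>(aD) \<psi>(-aD) is affine in \<psi>(aD), inversion makes the number of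
  representations an affine function of the indicator of D. The skew case uses u = 0 and the Paley
  case u = -1.\<close>

lemma diff_count_eq:
  assumes H: "\<And>a. a \<noteq> 0 \<Longrightarrow>
      (\<Sum>x\<in>D. \<psi> (a * x)) * (\<Sum>y\<in>D. \<psi> (- a * y)) = u * (\<Sum>x\<in>D. \<psi> (a * x)) + v"
    and g: "g \<noteq> 0"
  shows "of_nat CARD('a) * of_nat (diff_count D g) =
    of_nat (card D) ^ 2 + u * (of_nat CARD('a) * of_bool (g \<in> D) - of_nat (card D)) - v"
proof -
  define h where "h a = (\<Sum>x\<in>D. \<psi> (a * x))" for a
  have h0: "h 0 = of_nat (card D)" by (simp add: h_def psi_0)
  have "of_nat CARD('a) * of_bool (g \<in> D) =
      (\<Sum>a\<in>UNIV. \<psi> (- (a * g)) * (\<Sum>x\<in>UNIV. of_bool (x \<in> D) * \<psi> (a * x)))"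
    by (rule fourier_inversion)
  also have "\<dots> = (\<Sum>a\<in>UNIV. \<psi> (- (a * g)) * h a)"
    unfolding h_def by (intro sum.cong refl arg_cong2[of _ _ _ _ "(*)"] sum.mono_neutral_cong_right) auto
  also have "\<dots> = h 0 + (\<Sum>a\<in>UNIV - {0}. \<psi> (- (a * g)) * h a)"
    by (subst sum.remove[of _ 0]) (simp_all add: psi_0)
  finally have 1: "(\<Sum>a\<in>UNIV - {0}. \<psi> (- (a * g)) * h a) =
      of_nat CARD('a) * of_bool (g \<in> D) - of_nat (card D)"
    by (simp add: h0 algebra_simps)
  have "of_nat CARD('a) * of_nat (diff_count D g) =
      (\<Sum>a\<in>UNIV. \<psi> (- (a * g)) * (h a * h (- a)))"
    using fourier_inversion[of "\<lambda>g. of_nat (diff_count D g)" g] unfolding sum_diff_count_psi h_def .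
  also have "\<dots> = h 0 * h 0 + (\<Sum>a\<in>UNIV - {0}. \<psi> (- (a * g)) * (h a * h (- a)))"
    by (subst sum.remove[of _ 0]) (simp_all add: psi_0)
  also have "(\<Sum>a\<in>UNIV - {0}. \<psi> (- (a * g)) * (h a * h (- a))) =
      (\<Sum>a\<in>UNIV - {0}. u * (\<psi> (- (a * g)) * h a) + v * \<psi> (- g * a))"
    by (intro sum.cong refl) (simp add: H[folded h_def] algebra_simps)
  also have "\<dots> = u * (\<Sum>a\<in>UNIV - {0}. \<psi> (- (a * g)) * h a) + v * (\<Sum>a\<in>UNIV - {0}. \<psi> (- g * a))"
    by (simp add: sum.distrib sum_distrib_left)
  also have "(\<Sum>a\<in>UNIV - {0}. \<psi> (- g * a)) = - 1"
    using g by (intro sum_psi_nonzero) simp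
  finally show ?thesis unfolding 1 h0 by (simp add: power2_eq_square)
qed

end

section \<open>The set D built from two-valued class sums\<close>

text \<open>\<open>U\<close> is the part \<open>L\<^sub>i\<close> of the paper, and \<open>B\<close> is \<open>\<plusminus> p\<^bsup>s\<theta>\<^esup>\<close> with the sign belonging to \<open>i\<close>.\<close>

locale two_valued_classes = character_pair \<gamma> \<chi> k \<psi> + quadratic_gauss \<gamma> \<psi>
  for \<gamma> :: "'a::finite_field" and \<chi> :: "'a \<Rightarrow> complex" and k :: nat and \<psi> :: "'a \<Rightarrow> complex" +
  fixes U :: "'a set" and B :: complex
  assumes odd_k: "odd k" and B_nonzero: "B \<noteq> 0"
    and U_nonzero: "0 \<notin> U" and U_inj: "inj_on \<chi> U"
    and gauss_eq: "\<not> k dvd j \<Longrightarrow> (\<Sum>x\<in>UNIV - {0}. \<chi> x ^ j * \<psi> x) = B * (\<Sum>z\<in>U. \<chi> z ^ j)"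
begin

definition in_classes :: "'a \<Rightarrow> bool" where
  "in_classes x \<longleftrightarrow> (\<exists>z\<in>U. \<chi> z = \<chi> x)"

definition D :: "'a set" where
  "D = {x. x \<noteq> 0 \<and> quad_char x = (if in_classes (inverse x) then - 1 else 1)}"

text \<open>Squaring is invertible on k-th roots of unity for odd k, with inverse the power
  (k+1)/2.\<close>

lemma chi_square_inj:
  assumes "x \<noteq> 0" "y \<noteq> 0" "\<chi> x ^ 2 = \<chi> y ^ 2"
  shows "\<chi> x = \<chi> y"
proof -
  obtain l where l: "k = 2 * l + 1" using odd_k by (auto elim: oddE)
  have *: "\<chi> z = (\<chi> z ^ 2) ^ (l + 1)" if "z \<noteq> 0" for z
  proof -
    have "(\<chi> z ^ 2) ^ (l + 1) = \<chi> z ^ Suc k" unfolding l power_mult[symmetric] by simp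
    thus ?thesis by (simp add: chi_power_order[OF that])
  qed
  show ?thesis using *[OF assms(1)] *[OF assms(2)] assms(3) by argo
qed

text \<open>The sum over C_0 of Salie sums is computed twice: through the class sums of 1/x, and
  through the Salie evaluation as the class sum of b. Both have the form A (...) + B (...) with the
  same A-part, which cancels, and B is nonzero.\<close>

lemma sum_quad_char_in_classes:
  assumes a: "a \<noteq> 0"
  obtains b where "(\<Sum>x\<in>UNIV - {0}. quad_char x * \<psi> (a * x) * of_bool (in_classes (inverse x))) =
    quad_char a * quad_gauss * of_bool (in_classes b)"
proof -
  define C where "C = {c. c \<noteq> 0 \<and> \<chi> c = 1}"
  define A where "A = - (1 + B * of_nat (card U)) / of_nat k"
  have class_sum: "(\<Sum>y | y \<noteq> 0 \<and> \<chi> y = \<chi> b. \<psi> y) = A + B * of_bool (in_classes b)" if "b \<noteq> 0" for b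
    unfolding A_def in_classes_def using class_sum_two_valued[OF U_nonzero U_inj gauss_eq that] .
  obtain n where n: "4 * a = \<gamma> ^ n" using a by (metis four_nonzero mult_eq_0_iff nonzero_powerE)
  obtain l where l: "k = 2 * l + 1" using odd_k by (auto elim: oddE)
  \<comment> \<open>A square root of 4a modulo C_0, namely (4a)^((k+1)/2); its square is (4a)^k
    times 4a, and \<chi> ignores k-th powers.\<close>
  define b where "b = \<gamma> ^ (n * (l + 1))"
  have "\<chi> b ^ 2 = \<chi> (\<gamma> ^ n) ^ k * \<chi> (\<gamma> ^ n)"
    by (simp add: b_def l chi_power algebra_simps flip: power_mult power_add)
  hence b: "\<chi> b ^ 2 = \<chi> (4 * a)" unfolding n by (simp add: chi_power_order)
  have C_shift: "(\<Sum>c\<in>C. \<psi> (c / x)) = A + B * of_bool (in_classes (inverse x))" if x: "x \<noteq> 0" for x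
  proof -
    have "(\<Sum>c\<in>C. \<psi> (c / x)) = (\<Sum>y | y \<noteq> 0 \<and> \<chi> y = \<chi> (inverse x). \<psi> y)"
      by (rule sum.reindex_bij_witness[of _ "\<lambda>y. y * x" "\<lambda>c. c / x"])
         (use x in \<open>auto simp: C_def chi_mult chi_divide chi_inverse chi_nonzero divide_inverse\<close>)
    thus ?thesis using class_sum[of "inverse x"] x by simp
  qed
  have "{y. y ^ 2 / (4 * a) \<in> C} = {y. y \<noteq> 0 \<and> \<chi> y = \<chi> b}"
  proof (intro subset_antisym subsetI)
    fix y assume "y \<in> {y. y ^ 2 / (4 * a) \<in> C}"
    hence y: "y \<noteq> 0" "\<chi> (y ^ 2 / (4 * a)) = 1" by (auto simp: C_def)
    hence "\<chi> y ^ 2 / \<chi> (4 * a) = 1" using a by (simp add: chi_divide chi_power)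
    hence "\<chi> y ^ 2 = \<chi> b ^ 2" using a by (simp add: b chi_nonzero)
    hence "\<chi> y = \<chi> b" by (intro chi_square_inj) (use y in \<open>auto simp: b_def\<close>)
    thus "y \<in> {y. y \<noteq> 0 \<and> \<chi> y = \<chi> b}" using y by blast
  next
    fix y assume "y \<in> {y. y \<noteq> 0 \<and> \<chi> y = \<chi> b}"
    hence y: "y \<noteq> 0" "\<chi> y = \<chi> b" by auto
    have "\<chi> (y ^ 2 / (4 * a)) = \<chi> y ^ 2 / \<chi> (4 * a)" using a y(1) by (simp add: chi_divide chi_power)
    also have "\<dots> = 1" using a by (simp add: y(2) b chi_nonzero)
    finally show "y \<in> {y. y ^ 2 / (4 * a) \<in> C}" using y a by (simp add: C_def)
  qed
  moreover have "b \<noteq> 0" by (simp add: b_def)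
  ultimately have rhs: "(\<Sum>y | y ^ 2 / (4 * a) \<in> C. \<psi> y) = A + B * of_bool (in_classes b)"
    using class_sum by simp
  define S where "S = (\<Sum>x\<in>UNIV - {0}. quad_char x * \<psi> (a * x) * of_bool (in_classes (inverse x)))"
  have "quad_char a * quad_gauss * (A + B * of_bool (in_classes b)) =
     (\<Sum>x\<in>UNIV - {0}. quad_char x * \<psi> (a * x) * (\<Sum>c\<in>C. \<psi> (c / x)))"
    unfolding rhs[symmetric] by (rule salie_sum_over_set[symmetric, OF a]) (simp add: C_def)
  also have "\<dots> = (\<Sum>x\<in>UNIV - {0}. A * (quad_char x * \<psi> (a * x)) +
      B * (quad_char x * \<psi> (a * x) * of_bool (in_classes (inverse x))))"
    by (intro sum.cong refl) (simp add: C_shift algebra_simps)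
  also have "\<dots> = A * (\<Sum>x\<in>UNIV - {0}. quad_char x * \<psi> (a * x)) + B * S"
    by (simp only: S_def sum.distrib sum_distrib_left)
  also have "(\<Sum>x\<in>UNIV - {0}. quad_char x * \<psi> (a * x)) = quad_char a * quad_gauss"
    unfolding sum_quad_char_psi[OF a, symmetric] by (intro sum.mono_neutral_left) auto
  finally have "B * S = quad_char a * quad_gauss * (A + B * of_bool (in_classes b)) - A * (quad_char a * quad_gauss)"
    by (simp only: add_diff_cancel_left')
  moreover have "q * g * (A + B * c) - A * (q * g) = B * (q * g * c)" for q g c
    by (simp add: algebra_simps)
  ultimately have "B * S = B * (quad_char a * quad_gauss * of_bool (in_classes b))"
    by (simp only:)
  hence "S = quad_char a * quad_gauss * of_bool (in_classes b)"
    by (rule iffD1[OF mult_left_cancel[OF B_nonzero]])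
  thus ?thesis using that unfolding S_def by blast
qed

lemma psi_D:
  assumes a: "a \<noteq> 0"
  obtains s where "s = 1 \<or> s = - 1" "(\<Sum>x\<in>D. \<psi> (a * x)) = (- 1 + s * quad_gauss) / 2"
proof -
  obtain b where b: "(\<Sum>x\<in>UNIV - {0}. quad_char x * \<psi> (a * x) * of_bool (in_classes (inverse x))) =
    quad_char a * quad_gauss * of_bool (in_classes b)"
    using sum_quad_char_in_classes[OF a] by blast
  have q: "(\<Sum>x\<in>UNIV - {0}. quad_char x * \<psi> (a * x)) = quad_char a * quad_gauss"
    unfolding sum_quad_char_psi[OF a, symmetric] by (intro sum.mono_neutral_left) auto
  \<comment> \<open>For x nonzero, twice the indicator of D is 1 + \<eta>(x) - 2 \<eta>(x)
    [1/x in the classes of U]; the three terms are summed separately.\<close>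
  have "2 * (\<Sum>x\<in>D. \<psi> (a * x)) = (\<Sum>x\<in>UNIV - {0}. 2 * of_bool (x \<in> D) * \<psi> (a * x))"
    unfolding sum_distrib_left by (intro sum.mono_neutral_cong_left) (auto simp: D_def)
  also have "\<dots> = (\<Sum>x\<in>UNIV - {0}. \<psi> (a * x) + quad_char x * \<psi> (a * x) -
      2 * (quad_char x * \<psi> (a * x) * of_bool (in_classes (inverse x))))"
  proof (intro sum.cong refl)
    fix x :: 'a assume "x \<in> UNIV - {0}"
    hence x: "x \<noteq> 0" by simp
    show "2 * of_bool (x \<in> D) * \<psi> (a * x) = \<psi> (a * x) + quad_char x * \<psi> (a * x) -
      2 * (quad_char x * \<psi> (a * x) * of_bool (in_classes (inverse x)))"
      using quad_char_cases[OF x] x by (auto simp: D_def)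
  qed
  also have "\<dots> = (\<Sum>x\<in>UNIV - {0}. \<psi> (a * x)) + (\<Sum>x\<in>UNIV - {0}. quad_char x * \<psi> (a * x)) -
      2 * (\<Sum>x\<in>UNIV - {0}. quad_char x * \<psi> (a * x) * of_bool (in_classes (inverse x)))"
    by (simp only: sum.distrib sum_subtractf sum_distrib_left)
  also have "\<dots> = - 1 + quad_char a * quad_gauss - 2 * (quad_char a * quad_gauss * of_bool (in_classes b))"
    unfolding q b sum_psi_nonzero[OF a] ..
  finally have e: "2 * (\<Sum>x\<in>D. \<psi> (a * x)) =
      - 1 + quad_char a * quad_gauss - 2 * (quad_char a * quad_gauss * of_bool (in_classes b))" .
  define s where "s = quad_char a * (1 - 2 * of_bool (in_classes b))"
  have s: "s = 1 \<or> s = - 1" unfolding s_def using quad_char_cases[OF a] by (cases "in_classes b") auto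
  have "2 * (\<Sum>x\<in>D. \<psi> (a * x)) = - 1 + s * quad_gauss"
    unfolding e s_def by (simp add: algebra_simps)
  moreover have "X = Y / 2" if "2 * X = Y" for X Y :: complex using that by auto
  ultimately have "(\<Sum>x\<in>D. \<psi> (a * x)) = (- 1 + s * quad_gauss) / 2" by blast
  with s show ?thesis by (rule that)
qed

lemma in_classes_cong: "\<chi> x = \<chi> y \<Longrightarrow> in_classes x = in_classes y"
  by (simp add: in_classes_def)

lemma D_nonzero: "0 \<notin> D"
  by (simp add: D_def)

text \<open>\<gamma>^k lies in C_0 but is a nonsquare because k is odd, so it keeps the class and
  flips \<eta>. This gives the size of D, and in the Paley case a vertex not adjacent to 0.\<close>

lemma gamma_power_k_mult_D:
  assumes "x \<noteq> 0"
  shows "\<gamma> ^ k * x \<in> D \<longleftrightarrow> x \<notin> D"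
proof -
  have "\<chi> (inverse (\<gamma> ^ k * x)) = \<chi> (inverse x)"
    using assms by (simp add: chi_inverse chi_mult chi_power chi_power_order)
  hence "in_classes (inverse (\<gamma> ^ k * x)) = in_classes (inverse x)" by (rule in_classes_cong)
  moreover have "quad_char (\<gamma> ^ k * x) = - quad_char x"
    using odd_k by (simp add: quad_char_mult quad_char_gamma_power)
  ultimately show ?thesis
    using assms quad_char_cases[OF assms] by (auto simp: D_def)
qed

lemma card_D: "2 * card D + 1 = CARD('a)"
proof -
  have "bij_betw (\<lambda>x. \<gamma> ^ k * x) D (UNIV - {0} - D)"
  proof (rule bij_betwI[where g = "\<lambda>y. y / \<gamma> ^ k"])
    show "(\<lambda>x. \<gamma> ^ k * x) \<in> D \<rightarrow> UNIV - {0} - D"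
      using gamma_power_k_mult_D D_nonzero by (auto simp: D_def)
    show "(\<lambda>y. y / \<gamma> ^ k) \<in> UNIV - {0} - D \<rightarrow> D"
    proof
      fix y assume y: "y \<in> UNIV - {0} - D"
      thus "y / \<gamma> ^ k \<in> D" using gamma_power_k_mult_D[of "y / \<gamma> ^ k"] by simp
    qed
  qed auto
  hence "card D = card (UNIV - {0} - D)" by (rule bij_betw_same_card)
  also have "\<dots> = CARD('a) - 1 - card D"
    using D_nonzero by (subst card_Diff_subset) (auto simp: card_Diff_subset)
  finally have "card D = CARD('a) - 1 - card D" .
  moreover have "card D \<le> CARD('a) - 1"
    using D_nonzero card_mono[of "UNIV - {0}" D] by (auto simp: card_Diff_subset)
  ultimately show ?thesis using card_gt_1 by linarith
qed

text \<open>\<chi>(-1) = 1 since k is odd, so negation acts on D only through \<eta>(-1).\<close>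

lemma minus_D:
  assumes "x \<noteq> 0"
  shows "- x \<in> D \<longleftrightarrow> (if CARD('a) mod 4 = 1 then x \<in> D else x \<notin> D)"
proof -
  have "\<chi> (- 1) ^ 2 = \<chi> 1 ^ 2" using chi_power[of "- 1" 2] by simp
  hence "\<chi> (- 1) = \<chi> 1" by (rule chi_square_inj[rotated 2]) auto
  hence "\<chi> (inverse (- x)) = \<chi> (inverse x)"
    using assms chi_mult[of "- 1" "inverse x"] by simp
  hence "in_classes (inverse (- x)) = in_classes (inverse x)" by (rule in_classes_cong)
  moreover have "quad_char (- x) = quad_char (- 1 :: 'a) * quad_char x"
    using quad_char_mult[of "- 1" x] by simp
  ultimately show ?thesis
    using assms quad_char_cases[OF assms] by (auto simp: D_def quad_char_minus_1)
qed

text \<open>The left side is (2 \<psi>(aD) + 1)^2, which removes the sign that depends on a.\<close>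

lemma psi_D_quadratic:
  assumes "a \<noteq> 0"
  shows "4 * (\<Sum>x\<in>D. \<psi> (a * x)) ^ 2 + 4 * (\<Sum>x\<in>D. \<psi> (a * x)) + 1 = quad_gauss ^ 2"
proof -
  obtain s where s: "s = 1 \<or> s = - 1" "(\<Sum>x\<in>D. \<psi> (a * x)) = (- 1 + s * quad_gauss) / 2"
    using psi_D[OF assms] .
  have "4 * ((- 1 + s * quad_gauss) / 2) ^ 2 + 4 * ((- 1 + s * quad_gauss) / 2) + 1 = s * s * quad_gauss ^ 2"
    by (simp add: power2_eq_square field_simps)
  also have "s * s = 1" using s(1) by auto
  finally show ?thesis unfolding s(2) by simp
qed

lemma D_skew:
  assumes q: "CARD('a) mod 4 = 3"
  shows "skew_hadamard_difference_set D"
proof -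
  have mD: "- x \<in> D \<longleftrightarrow> x \<notin> D" if "x \<noteq> 0" for x using minus_D[OF that] q by simp
  have uD: "x \<in> uminus ` D \<longleftrightarrow> - x \<in> D" for x by (metis add.inverse_inverse imageE imageI)
  have nD: "- x \<notin> D" if "x \<in> D" for x using that mD D_nonzero by metis
  hence "D \<inter> uminus ` D = {}" by (auto simp: uD)
  moreover have "D \<union> uminus ` D \<union> {0} = UNIV" using mD by (auto simp: uD)
  moreover have "0 \<notin> uminus ` D" using D_nonzero by (simp add: uD)
  moreover have "difference_set D"
    unfolding difference_set_def
  proof (intro exI allI impI)
    fix g :: 'a assume g: "g \<noteq> 0"
    \<comment> \<open>-D is the complement of D among the nonzero elements, so \<psi>(-aD) = -1 -
      \<psi>(aD), and \<open>psi_D_quadratic\<close> makes the product constant.\<close>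
    have H: "(\<Sum>x\<in>D. \<psi> (a * x)) * (\<Sum>y\<in>D. \<psi> (- a * y)) =
        0 * (\<Sum>x\<in>D. \<psi> (a * x)) + (of_nat CARD('a) + 1) / 4" if a: "a \<noteq> 0" for a
    proof -
      define H where "H = (\<Sum>x\<in>D. \<psi> (a * x))"
      have "(\<Sum>y\<in>D. \<psi> (- a * y)) = (\<Sum>x\<in>UNIV - {0} - D. \<psi> (a * x))"
        by (rule sum.reindex_bij_witness[of _ uminus uminus]) (use mD nD D_nonzero in auto)
      also have "\<dots> = (\<Sum>x\<in>UNIV - {0}. \<psi> (a * x)) - H"
        unfolding H_def using D_nonzero by (subst sum_diff) auto
      finally have "(\<Sum>y\<in>D. \<psi> (- a * y)) = - 1 - H" by (simp add: sum_psi_nonzero[OF a])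
      moreover have h: "- (4 * H ^ 2 + 4 * H + 1) = of_nat CARD('a)"
        using psi_D_quadratic[OF a] unfolding H_def[symmetric] quad_gauss_squared
        using q by (simp add: quad_char_minus_1)
      have "H * (- 1 - H) = (of_nat CARD('a) + 1) / 4"
        unfolding h[symmetric] by (simp add: power2_eq_square field_simps)
      ultimately show ?thesis unfolding H_def[symmetric] by simp
    qed
    have "complex_of_nat CARD('a) * of_nat (diff_count D g) = of_nat (card D) ^ 2 - (of_nat CARD('a) + 1) / 4"
      using diff_count_eq[OF H g] by simp
    \<comment> \<open>Denominators and negative terms are cleared, so that the complex identity
      descends to the naturals.\<close>
    hence "complex_of_nat (4 * (CARD('a) * diff_count D g) + CARD('a) + 1) = of_nat (4 * card D ^ 2)"
      by (simp add: field_simps)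
    hence "4 * (CARD('a) * diff_count D g) + CARD('a) + 1 = 4 * card D ^ 2" by (simp only: of_nat_eq_iff)
    moreover obtain d where d: "CARD('a) = 4 * d + 3" using q by (metis mult_div_mod_eq)
    moreover have "card D = 2 * d + 1" using card_D d by simp
    ultimately have "(4 * d + 3) * diff_count D g = (4 * d + 3) * d"
      by (simp add: power2_eq_square algebra_simps)
    hence "diff_count D g = d" by (simp only: mult_cancel1) simp
    thus "card {(x, y). x \<in> D \<and> y \<in> D \<and> x - y = g} = (CARD('a) - 3) div 4"
      by (simp add: diff_count_def d)
  qed
  ultimately show ?thesis
    using odd_card D_nonzero by (simp add: skew_hadamard_difference_set_def)
qed

lemma D_paley:
  assumes q: "CARD('a) mod 4 = 1"
  shows "paley_type_pds D"
proof -
  have mD: "- x \<in> D \<longleftrightarrow> x \<in> D" for x using minus_D[of x] q D_nonzero by (cases "x = 0") auto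
  have "CARD('a) = 4 * (CARD('a) div 4) + 1" using q by (metis mult_div_mod_eq)
  \<comment> \<open>Excluding q = 1 allows q = 4d + 5, so that the parameter (q-5)/4 is the natural
    number d.\<close>
  moreover have "CARD('a) div 4 \<noteq> 0" using card_gt_1 q by (intro notI) simp
  ultimately obtain d where d: "CARD('a) = 4 * d + 5"
    by (cases "CARD('a) div 4") auto
  have cD: "card D = 2 * d + 2" using card_D d by simp
  have count: "diff_count D g = (if g \<in> D then d else d + 1)" if g: "g \<noteq> 0" for g
  proof -
    \<comment> \<open>D = -D, so the product is the square of \<psi>(aD), which the quadratic
      relation makes linear.\<close>
    have H: "(\<Sum>x\<in>D. \<psi> (a * x)) * (\<Sum>y\<in>D. \<psi> (- a * y)) =
        (- 1) * (\<Sum>x\<in>D. \<psi> (a * x)) + (of_nat CARD('a) - 1) / 4" if a: "a \<noteq> 0" for a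
    proof -
      define H where "H = (\<Sum>x\<in>D. \<psi> (a * x))"
      have "(\<Sum>y\<in>D. \<psi> (- a * y)) = H"
        unfolding H_def by (rule sum.reindex_bij_witness[of _ uminus uminus]) (use mD in auto)
      moreover have h: "4 * H ^ 2 + 4 * H + 1 = of_nat CARD('a)"
        using psi_D_quadratic[OF a] unfolding H_def[symmetric] quad_gauss_squared
        using q by (simp add: quad_char_minus_1)
      have "H * H = - 1 * H + (of_nat CARD('a) - 1) / 4"
        unfolding h[symmetric] by (simp add: power2_eq_square field_simps)
      ultimately show ?thesis unfolding H_def[symmetric] by simp
    qed
    have "complex_of_nat CARD('a) * of_nat (diff_count D g) =
        of_nat (card D) ^ 2 + (- 1) * (of_nat CARD('a) * of_bool (g \<in> D) - of_nat (card D))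
        - (of_nat CARD('a) - 1) / 4"
      by (rule diff_count_eq[OF H g])
    hence "complex_of_nat (4 * (CARD('a) * diff_count D g) + 4 * (CARD('a) * of_bool (g \<in> D)) + CARD('a)) =
        of_nat (4 * card D ^ 2 + 4 * card D + 1)"
      by (simp add: field_simps)
    hence "4 * (CARD('a) * diff_count D g) + 4 * (CARD('a) * of_bool (g \<in> D)) + CARD('a) =
      4 * card D ^ 2 + 4 * card D + 1" by (simp only: of_nat_eq_iff)
    hence "(4 * d + 5) * (diff_count D g + of_bool (g \<in> D)) = (4 * d + 5) * (d + 1)"
      by (simp add: d cD power2_eq_square algebra_simps)
    hence "diff_count D g + of_bool (g \<in> D) = d + 1" by (simp only: mult_cancel1) simp
    thus ?thesis by auto
  qed
  \<comment> \<open>A common neighbour z of x and y is a representation of y - x as the difference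
    of z - x and z - y in D.\<close>
  have card_nbrs: "card {z. cayley_graph D x z \<and> cayley_graph D y z} = diff_count D (y - x)" for x y
    unfolding diff_count_def
  proof (rule bij_betw_same_card[of "\<lambda>z. (z - x, z - y)"], rule bij_betwI[where g = "\<lambda>p. fst p + x"])
    show "(\<lambda>p. fst p + x) \<in> {(u, v). u \<in> D \<and> v \<in> D \<and> u - v = y - x} \<rightarrow>
        {z. cayley_graph D x z \<and> cayley_graph D y z}"
    proof
      fix p assume "p \<in> {(u, v). u \<in> D \<and> v \<in> D \<and> u - v = y - x}"
      then obtain u v where p: "p = (u, v)" "u \<in> D" "v \<in> D" "u - v = y - x" by auto
      have "u + x - y = u - (y - x)" by simp
      also have "\<dots> = v" unfolding p(4)[symmetric] by simp
      finally show "fst p + x \<in> {z. cayley_graph D x z \<and> cayley_graph D y z}"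
        using p by (simp add: cayley_graph_def)
    qed
  qed (auto simp: cayley_graph_def algebra_simps)
  have "srg (cayley_graph D) CARD('a) (card D) d (d + 1)"
    unfolding srg_def
  proof (intro conjI allI impI)
    show "cayley_graph D y x" if "cayley_graph D x y" for x y
      using that mD[of "y - x"] by (simp add: cayley_graph_def)
    show "\<not> cayley_graph D x x" for x using D_nonzero by (simp add: cayley_graph_def)
    have "D \<noteq> {}" using cD by auto
    then obtain x where "x \<in> D" by blast
    thus "\<exists>x y. cayley_graph D x y" by (intro exI[of _ 0] exI[of _ x]) (simp add: cayley_graph_def)
    have "\<gamma> ^ k * x \<notin> D" using gamma_power_k_mult_D[of x] \<open>x \<in> D\<close> D_nonzero by (metis)
    moreover have "\<gamma> ^ k * x \<noteq> 0" using \<open>x \<in> D\<close> D_nonzero by auto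
    ultimately show "\<exists>x y. x \<noteq> y \<and> \<not> cayley_graph D x y"
      by (intro exI[of _ 0] exI[of _ "\<gamma> ^ k * x"]) (simp add: cayley_graph_def)
    show "card {y. cayley_graph D x y} = card D" for x
      by (rule bij_betw_same_card[of "\<lambda>y. y - x"], rule bij_betwI[where g = "\<lambda>y. y + x"])
         (auto simp: cayley_graph_def)
    show "card {z. cayley_graph D x z \<and> cayley_graph D y z} = d" if "cayley_graph D x y" for x y
      unfolding card_nbrs using that count[of "y - x"] D_nonzero by (cases "y - x = 0") (auto simp: cayley_graph_def)
    show "card {z. cayley_graph D x z \<and> cayley_graph D y z} = d + 1"
      if "x \<noteq> y" "\<not> cayley_graph D x y" for x y
      unfolding card_nbrs using that count[of "y - x"] by (auto simp: cayley_graph_def)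
  qed simp
  moreover have "2 * card D + 1 = CARD('a)" "4 * d + 5 = CARD('a)" "4 * (d + 1) + 1 = CARD('a)"
    using card_D d by simp_all
  ultimately show ?thesis using odd_card unfolding paley_type_pds_def by blast
qed

end

text \<open>A residue modulo 2k is its residue modulo k plus a parity. \<open>I\<close> gives the
  odd lifts of L' and the third set the even lifts outside L' and 0; the singleton {0} restores the
  even lift of 0, which is wanted because 0 is not in L'.\<close>

lemma mem_lifted_index_set_iff:
  fixes k h r :: nat and L' I J :: "nat set"
  assumes k: "odd k" and L': "L' \<subseteq> {0..<k}" "0 \<notin> L'"
    and I: "I \<subseteq> {0..<2 * k}" "\<forall>x\<in>I. odd x" "(\<lambda>x. x mod k) ` I = L'"
    and h: "[2 * h = 1] (mod k)"
    and J: "J = {0} \<union> I \<union>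
              (\<lambda>y. (2 * y) mod (2 * k)) ` ({0..<k} - (\<lambda>z. (h * z) mod k) ` (L' \<union> {0}))"
    and r: "r < 2 * k"
  shows "r \<in> J \<longleftrightarrow> (if r mod k \<in> L' then odd r else even r)"
proof -
  have k0: "k > 0" using k by (rule odd_pos)
  have half: "y \<in> (\<lambda>z. (h * z) mod k) ` (L' \<union> {0}) \<longleftrightarrow> (2 * y) mod k \<in> L' \<union> {0}" if y: "y < k" for y
  proof
    assume "y \<in> (\<lambda>z. (h * z) mod k) ` (L' \<union> {0})"
    then obtain z where z: "z \<in> L' \<union> {0}" "y = (h * z) mod k" by blast
    have "z < k" using z(1) L'(1) k0 by auto
    have "[2 * y = 2 * h * z] (mod k)"
      unfolding z(2) cong_def by (simp add: mod_mult_right_eq mult.assoc)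
    also have "[2 * h * z = 1 * z] (mod k)" by (intro cong_mult h cong_refl)
    finally have "(2 * y) mod k = z" using \<open>z < k\<close> by (simp add: cong_def)
    thus "(2 * y) mod k \<in> L' \<union> {0}" using z(1) by simp
  next
    assume z: "(2 * y) mod k \<in> L' \<union> {0}"
    have "[h * ((2 * y) mod k) = 2 * h * y] (mod k)"
      unfolding cong_def by (simp add: mod_mult_right_eq mult_ac)
    also have "[2 * h * y = 1 * y] (mod k)" by (intro cong_mult h cong_refl)
    finally have "y = (h * ((2 * y) mod k)) mod k" using y by (simp add: cong_def)
    thus "y \<in> (\<lambda>z. (h * z) mod k) ` (L' \<union> {0})" using z by (rule image_eqI)
  qed
  have third: "r \<in> (\<lambda>y. (2 * y) mod (2 * k)) ` ({0..<k} - (\<lambda>z. (h * z) mod k) ` (L' \<union> {0})) \<longleftrightarrow>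
      even r \<and> r mod k \<notin> L' \<union> {0}"
  proof
    assume "r \<in> (\<lambda>y. (2 * y) mod (2 * k)) ` ({0..<k} - (\<lambda>z. (h * z) mod k) ` (L' \<union> {0}))"
    then obtain y where "r = (2 * y) mod (2 * k)" "y \<in> {0..<k} - (\<lambda>z. (h * z) mod k) ` (L' \<union> {0})"
      by (rule imageE)
    hence y: "r = (2 * y) mod (2 * k)" "y < k" "y \<notin> (\<lambda>z. (h * z) mod k) ` (L' \<union> {0})"
      by (simp_all only: Diff_iff atLeastLessThan_iff simp_thms)
    hence "r = 2 * y" by simp
    thus "even r \<and> r mod k \<notin> L' \<union> {0}" using y(3) unfolding half[OF y(2)] by simp
  next
    assume a: "even r \<and> r mod k \<notin> L' \<union> {0}"
    then obtain y where y: "r = 2 * y" by blast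
    hence "y < k" using r by simp
    moreover have "r = (2 * y) mod (2 * k)" using y r by simp
    ultimately show "r \<in> (\<lambda>y. (2 * y) mod (2 * k)) ` ({0..<k} - (\<lambda>z. (h * z) mod k) ` (L' \<union> {0}))"
      using a y half[of y] by (intro image_eqI[of _ _ y]) auto
  qed
  have second: "r \<in> I \<longleftrightarrow> odd r \<and> r mod k \<in> L'"
  proof
    assume "odd r \<and> r mod k \<in> L'"
    then obtain x where x: "x \<in> I" "x mod k = r mod k" "odd r" using I(3) by (metis imageE)
    have "odd x" "x < 2 * k" using x(1) I by auto
    \<comment> \<open>Chinese remainder theorem for the coprime moduli 2 and k: equal parity and
      equal residue modulo k force x = r.\<close>
    hence "[x = r] (mod 2)" using x(3) by (simp add: cong_def odd_iff_mod_2_eq_one)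
    moreover have "[x = r] (mod k)" using x(2) by (simp add: cong_def)
    ultimately have "[x = r] (mod (2 * k))" using k by (intro coprime_cong_mult_nat) auto
    hence "x = r" using \<open>x < 2 * k\<close> r by (simp add: cong_def)
    thus "r \<in> I" using x(1) by simp
  qed (use I in auto)
  have first: "even r \<and> r mod k = 0 \<longleftrightarrow> r = 0"
  proof
    assume a: "even r \<and> r mod k = 0"
    hence "2 * k dvd r" using k by (intro divides_mult) auto
    thus "r = 0" using r by (auto dest: dvd_imp_le)
  qed simp
  show ?thesis unfolding J using second third first L'(2) by (auto split: if_splits)
qed

theorem theorem3p2:
  fixes p k m s f q \<theta> h i :: nat
    and \<gamma> :: "'a::finite_field"
    and \<chi>\<^sub>k :: "'a \<Rightarrow> complex"
    and \<chi>\<^sub>k' :: "'b::finite_field \<Rightarrow> complex"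
    and \<epsilon> :: complex
    and L :: "'a set" and Lpart :: "nat \<Rightarrow> 'a set"
    and L' I J :: "nat set" and D :: "'a set" and \<delta> :: real
  assumes p: "prime p" "odd p"
    and k: "k > 1" "odd k"
    and m: "m = ord k p"
    and s: "s > 0"
    and f: "f = s * m"
    and q: "q = p ^ f"
    and card_Fq: "CARD('a) = q"
    and card_Fpm: "CARD('b) = p ^ m"
    and k_dvd: "k dvd (q - 1) div (p - 1)"
    and \<gamma>: "primitive_element \<gamma>"
    and cay_srg: "strongly_regular (cayley_graph (cyclotomic_class \<gamma> k 0))"
    and \<chi>\<^sub>k: "mult_char \<chi>\<^sub>k" "mult_char_order \<chi>\<^sub>k = k"
    and \<chi>\<^sub>k': "mult_char \<chi>\<^sub>k'" "mult_char_order \<chi>\<^sub>k' = k"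
    and \<theta>: "exactly_divides p \<theta> (gauss_sum \<chi>\<^sub>k')"
    and L: "coset_representatives (cyclotomic_class \<gamma> k 0) L"
    and L_partition: "L = Lpart 1 \<union> Lpart 2" "Lpart 1 \<inter> Lpart 2 = {}"
    and \<epsilon>: "\<epsilon> \<in> {1, -1}"
    and gauss: "gauss_sum \<chi>\<^sub>k = \<epsilon> * of_nat p ^ (s * \<theta>) * (\<Sum>x\<in>Lpart 1. \<chi>\<^sub>k x)"
               "gauss_sum \<chi>\<^sub>k = - \<epsilon> * of_nat p ^ (s * \<theta>) * (\<Sum>x\<in>Lpart 2. \<chi>\<^sub>k x)"
    and gauss_lower_order:
      "\<And>j. \<not> coprime j k \<Longrightarrow> \<not> k dvd j \<Longrightarrow>
         gauss_sum (\<lambda>x. \<chi>\<^sub>k x ^ j) = \<epsilon> * of_nat p ^ (s * \<theta>) * (\<Sum>x\<in>Lpart 1. \<chi>\<^sub>k x ^ j)"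
    and i: "i \<in> {1, 2}"
    and Li_C0: "Lpart i \<inter> cyclotomic_class \<gamma> k 0 = {}"
    and L': "L' = {y mod k | y. y \<le> q - 2 \<and> inverse \<gamma> ^ y \<in> Lpart i}"
    and I: "I \<subseteq> {0..<2 * k}" "\<forall>x\<in>I. odd x" "card I = card (Lpart i)"
           "(\<lambda>x. x mod k) ` I = L'"
    and h: "h < k" "[2 * h = 1] (mod k)"
    and J: "J = {0} \<union> I \<union>
              (\<lambda>y. (2 * y) mod (2 * k)) ` ({0..<k} - (\<lambda>z. (h * z) mod k) ` (L' \<union> {0}))"
    and D: "D = (\<Union>j\<in>J. cyclotomic_class \<gamma> (2 * k) j)"
    and \<delta>: "\<delta> = (if q mod 4 = 3 then -1 else 1)"
  shows "(\<forall>a. a \<noteq> 0 \<longrightarrow>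
            char_sum ((\<lambda>x. a * x) ` D) \<in>
              {(-1 + csqrt (of_real (\<delta> * real q))) / 2, (-1 - csqrt (of_real (\<delta> * real q))) / 2}) \<and>
         (q mod 4 = 3 \<longrightarrow> skew_hadamard_difference_set D) \<and>
         (q mod 4 = 1 \<longrightarrow> paley_type_pds D)"
proof -
  have char: "CHAR('a) = p"
  proof -
    have "CHAR('a) dvd p ^ f" using CHAR_dvd_CARD[where ?'a = 'a] by (simp add: card_Fq q)
    hence "CHAR('a) dvd p" using prime_dvd_power[OF CHAR_prime] by blast
    thus ?thesis using p(1) CHAR_prime[where ?'a = 'a] by (simp add: primes_dvd_imp_eq)
  qed
  have card: "CARD('a) = CHAR('a) ^ f" by (simp add: card_Fq q char)
  have odd_q: "odd CARD('a)" by (simp add: card_Fq q p(2))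
  interpret additive_character "canonical_char :: 'a \<Rightarrow> complex"
    by (rule additive_character_canonical_char[OF card])
  interpret mult_character \<gamma> \<chi>\<^sub>k k
    by unfold_locales (use \<gamma> \<chi>\<^sub>k in auto)
  interpret character_pair \<gamma> \<chi>\<^sub>k k "canonical_char :: 'a \<Rightarrow> complex" ..

  have L_nonzero: "L \<subseteq> UNIV - {0}" using L by (simp add: coset_representatives_def)
  have coset: "y \<in> (\<lambda>c. x * c) ` cyclotomic_class \<gamma> k 0 \<longleftrightarrow> \<chi>\<^sub>k x = \<chi>\<^sub>k y" if "x \<noteq> 0" "y \<noteq> 0" for x y
    unfolding chi_eq_iff_class[OF that] using that(1)
    by (auto intro: image_eqI[of _ _ "y / x"])
  have L_ex1: "\<exists>!y. y \<in> L \<and> \<chi>\<^sub>k x = \<chi>\<^sub>k y" if x: "x \<noteq> 0" for x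
  proof -
    have "\<exists>!y. y \<in> L \<and> y \<in> (\<lambda>c. x * c) ` cyclotomic_class \<gamma> k 0"
      using L x by (simp add: coset_representatives_def)
    moreover have "y \<in> L \<and> y \<in> (\<lambda>c. x * c) ` cyclotomic_class \<gamma> k 0 \<longleftrightarrow> y \<in> L \<and> \<chi>\<^sub>k x = \<chi>\<^sub>k y" for y
      using coset[OF x] L_nonzero by blast
    ultimately show ?thesis by simp
  qed
  have L_inj: "inj_on \<chi>\<^sub>k L"
    using L_ex1 L_nonzero by (intro inj_onI) blast
  have L_image: "\<chi>\<^sub>k ` L = \<chi>\<^sub>k ` (UNIV - {0})"
  proof (intro subset_antisym subsetI)
    fix u assume "u \<in> \<chi>\<^sub>k ` (UNIV - {0})"
    then obtain x where "x \<noteq> 0" "u = \<chi>\<^sub>k x" by auto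
    thus "u \<in> \<chi>\<^sub>k ` L" using L_ex1[of x] by auto
  qed (use L_nonzero in auto)

  \<comment> \<open>Conjugation needs a relation with integer coefficients, so the complex sign
    \<epsilon> is absorbed into an integer.\<close>
  define c1 :: int where "c1 = (if \<epsilon> = 1 then 1 else - 1) * int p ^ (s * \<theta>)"
  have c1: "of_int c1 = \<epsilon> * of_nat p ^ (s * \<theta>)" using \<epsilon> by (auto simp: c1_def)
  have G1: "(\<Sum>x\<in>UNIV - {0}. \<chi>\<^sub>k x ^ j * canonical_char x) = of_int c1 * (\<Sum>x\<in>Lpart 1. \<chi>\<^sub>k x ^ j)"
    if j: "\<not> k dvd j" for j
  \<comment> \<open>Conjugating the case j = 1 settles the coprime exponents; the remaining ones are
    covered by \<open>gauss_lower_order\<close>.\<close>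
  proof (cases "coprime j k")
    case True
    have "j > 0" using j by (intro Nat.gr0I) auto
    moreover have "k dvd (CARD('a) - 1) div (CHAR('a) - 1)" using k_dvd unfolding card_Fq char .
    moreover have "0 \<notin> Lpart 1" using L_nonzero L_partition by auto
    moreover have "(\<Sum>x\<in>UNIV - {0}. \<chi>\<^sub>k x * canonical_char x) = of_int c1 * (\<Sum>x\<in>Lpart 1. \<chi>\<^sub>k x)"
      using gauss(1) unfolding gauss_sum_def c1 .
    ultimately show ?thesis using gauss_sum_eq_power_coprime[OF card] True by blast
  next
    case False
    show ?thesis using gauss_lower_order[OF False j] unfolding gauss_sum_def c1 .
  qed
  \<comment> \<open>Every nontrivial power has opposite sums over the two parts of L, so choosing
    the second part only changes the sign.\<close>
  define B :: complex where "B = of_int (if i = 1 then c1 else - c1)"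
  have GB: "(\<Sum>x\<in>UNIV - {0}. \<chi>\<^sub>k x ^ j * canonical_char x) = B * (\<Sum>x\<in>Lpart i. \<chi>\<^sub>k x ^ j)"
    if j: "\<not> k dvd j" for j
  proof -
    have "(\<Sum>x\<in>Lpart 1. \<chi>\<^sub>k x ^ j) + (\<Sum>x\<in>Lpart 2. \<chi>\<^sub>k x ^ j) = (\<Sum>x\<in>L. \<chi>\<^sub>k x ^ j)"
      unfolding L_partition(1) by (rule sum.union_disjoint[OF finite finite L_partition(2), symmetric])
    also have "\<dots> = 0" by (rule sum_chi_transversal[OF L_inj L_image j])
    finally have 1: "(\<Sum>x\<in>Lpart 1. \<chi>\<^sub>k x ^ j) = - (\<Sum>x\<in>Lpart 2. \<chi>\<^sub>k x ^ j)" by (simp add: eq_neg_iff_add_eq_0)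
    show ?thesis
    proof (cases "i = 1")
      case False
      hence "i = 2" using i by simp
      thus ?thesis unfolding G1[OF j] 1 by (simp add: B_def)
    qed (simp add: G1[OF j] B_def)
  qed
  interpret tv: two_valued_classes \<gamma> \<chi>\<^sub>k k "canonical_char :: 'a \<Rightarrow> complex" "Lpart i" B
  proof
    show "odd CARD('a)" by (rule odd_q)
    show "odd k" by (rule k)
    show "B \<noteq> 0" using p by (auto simp: B_def c1_def)
    have "Lpart i \<subseteq> L" using i L_partition(1) by auto
    thus "0 \<notin> Lpart i" "inj_on \<chi>\<^sub>k (Lpart i)" using L_nonzero L_inj by (auto intro: inj_on_subset)
  qed (rule GB)

  \<comment> \<open>L' consists of logarithms of inverses of elements of L_i, which matches the
    inverse in \<open>tv.D\<close>. The bound q - 2 still admits every logarithm modulo q -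
    1.\<close>
  have in_classes: "tv.in_classes (inverse (\<gamma> ^ n)) \<longleftrightarrow> n mod k \<in> L'" for n
  proof
    assume "tv.in_classes (inverse (\<gamma> ^ n))"
    then obtain z where z: "z \<in> Lpart i" "\<chi>\<^sub>k z = \<chi>\<^sub>k (inverse (\<gamma> ^ n))" by (auto simp: tv.in_classes_def)
    hence "z \<noteq> 0" using tv.U_nonzero by auto
    hence "inverse z \<in> UNIV - {0}" by simp
    then obtain y where y: "y < CARD('a) - 1" "inverse z = \<gamma> ^ y" unfolding gamma_power_image[symmetric] by auto
    hence zy: "z = inverse \<gamma> ^ y" by (metis inverse_inverse_eq power_inverse)
    have "inverse (\<chi>\<^sub>k (\<gamma> ^ y)) = inverse (\<chi>\<^sub>k (\<gamma> ^ n))"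
      using z(2) unfolding zy by (simp add: chi_inverse chi_power power_inverse)
    hence "y mod k = n mod k" using chi_gamma_power_eq_iff by (simp add: cong_def)
    moreover have "y \<le> q - 2" using y(1) by (simp add: card_Fq)
    ultimately show "n mod k \<in> L'" unfolding L' using z(1) zy by (metis (mono_tags, lifting) mem_Collect_eq)
  next
    assume "n mod k \<in> L'"
    then obtain y where y: "n mod k = y mod k" "inverse \<gamma> ^ y \<in> Lpart i" unfolding L' by blast
    have "\<chi>\<^sub>k (\<gamma> ^ y) = \<chi>\<^sub>k (\<gamma> ^ n)" using y(1) chi_gamma_power_eq_iff by (simp add: cong_def)
    hence "\<chi>\<^sub>k (inverse \<gamma> ^ y) = \<chi>\<^sub>k (inverse (\<gamma> ^ n))" by (simp add: chi_inverse chi_power power_inverse)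
    thus "tv.in_classes (inverse (\<gamma> ^ n))" unfolding tv.in_classes_def using y(2) by blast
  qed
  have k0: "k > 0" using k by simp
  have L'_sub: "L' \<subseteq> {0..<k}" using k0 by (auto simp: L')
  \<comment> \<open>A class of L_i with logarithm 0 modulo k would be C_0, which L_i avoids.\<close>
  have "0 \<notin> L'"
  proof
    assume "0 \<in> L'"
    hence "tv.in_classes 1" using in_classes[of 0] by simp
    then obtain z where z: "z \<in> Lpart i" "\<chi>\<^sub>k z = \<chi>\<^sub>k 1" by (auto simp: tv.in_classes_def)
    moreover have "z \<noteq> 0" using z(1) tv.U_nonzero by auto
    ultimately have "z \<in> cyclotomic_class \<gamma> k 0" using chi_eq_iff_class[of 1 z] by simp
    thus False using z(1) Li_C0 by blast
  qed
  note J_iff = mem_lifted_index_set_iff[OF k(2) L'_sub this I(1,2,4) h(2) J]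
  have k2: "2 * k dvd CARD('a) - 1"
    using order_dvd_card odd_q k(2) by (intro divides_mult) auto
  have J_less: "j < 2 * k" if "j \<in> J" for j using that I(1) k0 unfolding J by auto
  have D_eq: "D = tv.D"
  proof -
    have "\<gamma> ^ n \<in> D \<longleftrightarrow> \<gamma> ^ n \<in> tv.D" for n
    proof -
      have "\<gamma> ^ n \<in> D \<longleftrightarrow> (\<exists>j\<in>J. n mod (2 * k) = j)"
        unfolding D using J_less by (auto simp: cyclotomic_class_iff[OF k2] cong_def)
      also have "\<dots> \<longleftrightarrow> n mod (2 * k) \<in> J" by blast
      also have "\<dots> \<longleftrightarrow> (if n mod k \<in> L' then odd n else even n)"
        using J_iff[of "n mod (2 * k)"] k0 by (simp add: mod_mod_cancel dvd_mod_iff)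
      also have "\<dots> \<longleftrightarrow> \<gamma> ^ n \<in> tv.D"
        by (simp add: tv.D_def in_classes tv.quad_char_gamma_power)
      finally show ?thesis .
    qed
    moreover have "x \<noteq> 0" if "x \<in> D" for x
      using that cyclotomic_class_nonzero unfolding D by blast
    ultimately show ?thesis
      using tv.D_nonzero by (intro subset_antisym subsetI) (metis nonzero_powerE)+
  qed

  have q_mod: "q mod 4 = 1 \<or> q mod 4 = 3" using odd_q unfolding card_Fq by presburger
  \<comment> \<open>Comparing squares fixes the Gauss sum up to sign, which the two-element set in
    the conclusion absorbs.\<close>
  have "tv.quad_gauss ^ 2 = of_real (\<delta> * real q)"
    using q_mod by (auto simp: tv.quad_gauss_squared tv.quad_char_minus_1 card_Fq \<delta>)
  hence "tv.quad_gauss ^ 2 = csqrt (of_real (\<delta> * real q)) ^ 2" by simp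
  hence G: "tv.quad_gauss = csqrt (of_real (\<delta> * real q)) \<or> tv.quad_gauss = - csqrt (of_real (\<delta> * real q))"
    by (simp only: power2_eq_iff)
  have "char_sum ((\<lambda>x. a * x) ` D) \<in>
      {(-1 + csqrt (of_real (\<delta> * real q))) / 2, (-1 - csqrt (of_real (\<delta> * real q))) / 2}"
    if a: "a \<noteq> 0" for a
  proof -
    have "char_sum ((\<lambda>x. a * x) ` D) = (\<Sum>x\<in>D. canonical_char (a * x))"
      unfolding char_sum_def using a by (subst sum.reindex) (auto intro: inj_onI)
    moreover obtain s' where "s' = 1 \<or> s' = - 1"
      "(\<Sum>x\<in>tv.D. canonical_char (a * x)) = (- 1 + s' * tv.quad_gauss) / 2"
      using tv.psi_D[OF a] .
    ultimately show ?thesis using G unfolding D_eq by auto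
  qed
  moreover have "skew_hadamard_difference_set D" if "q mod 4 = 3"
    unfolding D_eq using that by (intro tv.D_skew) (simp add: card_Fq)
  moreover have "paley_type_pds D" if "q mod 4 = 1"
    unfolding D_eq using that by (intro tv.D_paley) (simp add: card_Fq)
  ultimately show ?thesis by blast
qed

end
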